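(* Let $\mathcal R_{\mathcal T}=\mathcal N\rtimes\mathcal T$ be a solvable Lie algebra of maximal rank whose nilradical $\mathcal N$ has rank two and is generated by two elements, with primitive weights $\alpha_1,\alpha_2$, set of weights $W$, and one-dimensional weight spaces (see context). Assume that $3\alpha_1+\alpha_2\notin W$ and $\alpha_1+3\alpha_2\notin W$. Then $\mathcal R_{\mathcal T}$ is cohomologically rigid, i.e. $H^2(\mathcal R_{\mathcal T},\mathcal R_{\mathcal T})=0$.
   Context: All algebras and modules are finite-dimensional over $\mathbb C$. Let $\mathcal N$ be a nilpotent Lie algebra and $\mathcal T$ a maximal torus of $\mathcal N$, i.e. a maximal abelian subalgebra of $\mathrm{Der}(\mathcal N)$ consisting of diagonalizable derivations. $\mathcal R_{\mathcal T}:=\mathcal N\rtimes\mathcal T$ is the semidirect product ($\mathcal T$ abelian, $[x,e]=x(e)$ for $x\in\mathcal T$, $e\in\mathcal N$). Write $\mathcal N=\bigoplus_{\alpha\in W}\mathcal N_\alpha$ for the weight decomposition, where $W\subset\mathcal T^*$ is the set of weights of $\mathcal T$ on $\mathcal N$. Setting: $\dim\mathcal T=\dim(\mathcal N/[\mathcal N,\mathcal N])=2$, and $\dim\mathcal N_\alpha=1$ for all $\alpha\in W$, $\mathcal N_\alpha=\mathbb C e_\alpha$. The primitive weights $\alpha_1,\alpha_2$ are the two (linearly independent) weights of $\mathcal T$ on $\mathcal N/[\mathcal N,\mathcal N]$, so $\mathcal N$ is generated by $e_{\alpha_1},e_{\alpha_2}$ and every weight is uniquely $p\alpha_1+q\alpha_2$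 with non-negative integers $p,q$. It is also assumed that the nilindex of $\mathcal N$ (the smallest $k$ with $\mathcal N^k=0$, where $\mathcal N^1=\mathcal N$, $\mathcal N^{k+1}=[\mathcal N,\mathcal N^k]$) is greater than $3$. $H^2(\mathcal R_{\mathcal T},\mathcal R_{\mathcal T})$ is Chevalley--Eilenberg cohomology with coefficients in the adjoint module. *)

theory Defs
  imports Complex_Main "HOL-Library.Function_Algebras" "HOL-Library.Product_Plus"
begin

section \<open>Lie algebras\<close>

text \<open>A Lie algebra lives on a subspace \<open>L\<close> of an ambient vector space \<open>'v\<close>; the values of the
  bracket outside \<open>L\<close> are irrelevant.\<close>

locale lie_algebra = vector_space scale
  for scale :: "'k::field \<Rightarrow> 'v::ab_group_add \<Rightarrow> 'v" +
  fixes L :: "'v set" and br :: "'v \<Rightarrow> 'v \<Rightarrow> 'v"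
  assumes subspace_carrier: "subspace L"
    and br_closed: "\<lbrakk>x \<in> L; y \<in> L\<rbrakk> \<Longrightarrow> br x y \<in> L"
    and br_add_left: "\<lbrakk>x \<in> L; y \<in> L; z \<in> L\<rbrakk> \<Longrightarrow> br (x + y) z = br x z + br y z"
    and br_add_right: "\<lbrakk>x \<in> L; y \<in> L; z \<in> L\<rbrakk> \<Longrightarrow> br x (y + z) = br x y + br x z"
    and br_scale_left: "\<lbrakk>x \<in> L; y \<in> L\<rbrakk> \<Longrightarrow> br (scale c x) y = scale c (br x y)"
    and br_scale_right: "\<lbrakk>x \<in> L; y \<in> L\<rbrakk> \<Longrightarrow> br x (scale c y) = scale c (br x y)"
    and br_self: "x \<in> L \<Longrightarrow> br x x = 0"
    and jacobi: "\<lbrakk>x \<in> L; y \<in> L; z \<in> L\<rbrakk> \<Longrightarrow> br x (br y z) + br y (br z x) + br z (br x y) = 0"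

definition finite_dim :: "('k::field \<Rightarrow> 'v::ab_group_add \<Rightarrow> 'v) \<Rightarrow> bool" where
  "finite_dim s \<longleftrightarrow> (\<exists>B. finite B \<and> module.span s B = UNIV)"

subsection \<open>Nilpotency\<close>

definition bracket_span ::
  "('k::field \<Rightarrow> 'v::ab_group_add \<Rightarrow> 'v) \<Rightarrow> ('v \<Rightarrow> 'v \<Rightarrow> 'v) \<Rightarrow> 'v set \<Rightarrow> 'v set \<Rightarrow> 'v set" where
  "bracket_span s br A B = module.span s {br a b |a b. a \<in> A \<and> b \<in> B}"

abbreviation derived_subalgebra where
  "derived_subalgebra s br \<equiv> bracket_span s br UNIV UNIV"

text \<open>The series starts at index 1; the value at index 0 is a dummy.\<close>

fun lower_central ::
  "('k::field \<Rightarrow> 'v::ab_group_add \<Rightarrow> 'v) \<Rightarrow> ('v \<Rightarrow> 'v \<Rightarrow> 'v) \<Rightarrow> nat \<Rightarrow> 'v set" where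
  "lower_central s br 0 = UNIV"
| "lower_central s br (Suc 0) = UNIV"
| "lower_central s br (Suc (Suc k)) = bracket_span s br UNIV (lower_central s br (Suc k))"

definition nilpotent_lie ::
  "('k::field \<Rightarrow> 'v::ab_group_add \<Rightarrow> 'v) \<Rightarrow> ('v \<Rightarrow> 'v \<Rightarrow> 'v) \<Rightarrow> bool" where
  "nilpotent_lie s br \<longleftrightarrow> (\<exists>k\<ge>1. lower_central s br k = {0})"

definition nilindex ::
  "('k::field \<Rightarrow> 'v::ab_group_add \<Rightarrow> 'v) \<Rightarrow> ('v \<Rightarrow> 'v \<Rightarrow> 'v) \<Rightarrow> nat" where
  "nilindex s br = (LEAST k. k \<ge> 1 \<and> lower_central s br k = {0})"

definition quotient_dim :: "('k::field \<Rightarrow> 'v::ab_group_add \<Rightarrow> 'v) \<Rightarrow> 'v set \<Rightarrow> nat" where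
  "quotient_dim s U = vector_space.dim s UNIV - vector_space.dim s U"

subsection \<open>Derivations, tori and weights\<close>

definition derivations ::
  "('k::field \<Rightarrow> 'v::ab_group_add \<Rightarrow> 'v) \<Rightarrow> ('v \<Rightarrow> 'v \<Rightarrow> 'v) \<Rightarrow> ('v \<Rightarrow> 'v) set" where
  "derivations s br =
     {D. Vector_Spaces.linear s s D \<and> (\<forall>u v. D (br u v) = br (D u) v + br u (D v))}"

definition diagonalizable ::
  "('k::field \<Rightarrow> 'v::ab_group_add \<Rightarrow> 'v) \<Rightarrow> ('v \<Rightarrow> 'v) \<Rightarrow> bool" where
  "diagonalizable s D \<longleftrightarrow>
     (\<exists>B. \<not> module.dependent s B \<and> module.span s B = UNIV \<and> (\<forall>b\<in>B. \<exists>c. D b = s c b))"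

definition fun_scale :: "('k \<Rightarrow> 'v \<Rightarrow> 'v) \<Rightarrow> 'k \<Rightarrow> ('v \<Rightarrow> 'v) \<Rightarrow> ('v \<Rightarrow> 'v)" where
  "fun_scale s c f = (\<lambda>v. s c (f v))"

definition torus ::
  "('k::field \<Rightarrow> 'v::ab_group_add \<Rightarrow> 'v) \<Rightarrow> ('v \<Rightarrow> 'v \<Rightarrow> 'v) \<Rightarrow> ('v \<Rightarrow> 'v) set \<Rightarrow> bool" where
  "torus s br T \<longleftrightarrow>
     module.subspace (fun_scale s) T \<and> T \<subseteq> derivations s br \<and>
     (\<forall>x\<in>T. \<forall>y\<in>T. x \<circ> y = y \<circ> x) \<and> (\<forall>x\<in>T. diagonalizable s x)"

definition maximal_torus ::
  "('k::field \<Rightarrow> 'v::ab_group_add \<Rightarrow> 'v) \<Rightarrow> ('v \<Rightarrow> 'v \<Rightarrow> 'v) \<Rightarrow> ('v \<Rightarrow> 'v) set \<Rightarrow> bool" where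
  "maximal_torus s br T \<longleftrightarrow>
     torus s br T \<and> (\<forall>T'. torus s br T' \<and> T \<subseteq> T' \<longrightarrow> T' = T)"

text \<open>Linear functionals on \<open>T\<close> are represented by their extension by 0 outside \<open>T\<close>, so that
  equality of functions is equality in the dual space and pointwise linear combinations stay in
  the dual space.\<close>

definition dual_space ::
  "('k::field \<Rightarrow> 'v::ab_group_add \<Rightarrow> 'v) \<Rightarrow> ('v \<Rightarrow> 'v) set \<Rightarrow> (('v \<Rightarrow> 'v) \<Rightarrow> 'k) set" where
  "dual_space s T =
     {\<alpha>. (\<forall>x\<in>T. \<forall>y\<in>T. \<alpha> (x + y) = \<alpha> x + \<alpha> y) \<and>
         (\<forall>c. \<forall>x\<in>T. \<alpha> (fun_scale s c x) = c * \<alpha> x) \<and> (\<forall>x. x \<notin> T \<longrightarrow> \<alpha> x = 0)}"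

definition weight_space ::
  "('k::field \<Rightarrow> 'v::ab_group_add \<Rightarrow> 'v) \<Rightarrow> ('v \<Rightarrow> 'v) set \<Rightarrow> (('v \<Rightarrow> 'v) \<Rightarrow> 'k) \<Rightarrow> 'v set" where
  "weight_space s T \<alpha> = {e. \<forall>x\<in>T. x e = s (\<alpha> x) e}"

definition weights ::
  "('k::field \<Rightarrow> 'v::ab_group_add \<Rightarrow> 'v) \<Rightarrow> ('v \<Rightarrow> 'v) set \<Rightarrow> (('v \<Rightarrow> 'v) \<Rightarrow> 'k) set" where
  "weights s T = {\<alpha> \<in> dual_space s T. weight_space s T \<alpha> \<noteq> {0}}"

text \<open>The weights of \<open>T\<close> on the quotient by the derived subalgebra, where \<open>e\<close> is a representative of a
  nonzero weight vector of the quotient.\<close>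

definition primitive_weights ::
  "('k::field \<Rightarrow> 'v::ab_group_add \<Rightarrow> 'v) \<Rightarrow> ('v \<Rightarrow> 'v \<Rightarrow> 'v) \<Rightarrow> ('v \<Rightarrow> 'v) set
    \<Rightarrow> (('v \<Rightarrow> 'v) \<Rightarrow> 'k) set" where
  "primitive_weights s br T =
     {\<alpha> \<in> dual_space s T. \<exists>e. e \<notin> derived_subalgebra s br \<and>
        (\<forall>x\<in>T. x e - s (\<alpha> x) e \<in> derived_subalgebra s br)}"

subsection \<open>The semidirect product with an abelian Lie algebra of derivations\<close>

definition semidirect_carrier :: "('v \<Rightarrow> 'v) set \<Rightarrow> ('v \<times> ('v \<Rightarrow> 'v)) set" where
  "semidirect_carrier T = UNIV \<times> T"

definition semidirect_scale ::
  "('k \<Rightarrow> 'v \<Rightarrow> 'v) \<Rightarrow> 'k \<Rightarrow> 'v \<times> ('v \<Rightarrow> 'v) \<Rightarrow> 'v \<times> ('v \<Rightarrow> 'v)" where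
  "semidirect_scale s c p = (s c (fst p), fun_scale s c (snd p))"

definition semidirect_bracket ::
  "('v \<Rightarrow> 'v \<Rightarrow> 'v) \<Rightarrow> 'v::ab_group_add \<times> ('v \<Rightarrow> 'v) \<Rightarrow> 'v \<times> ('v \<Rightarrow> 'v) \<Rightarrow> 'v \<times> ('v \<Rightarrow> 'v)" where
  "semidirect_bracket br p q = (br (fst p) (fst q) + snd p (fst q) - snd q (fst p), 0)"

section \<open>Chevalley--Eilenberg cohomology in degree 2, adjoint coefficients\<close>

text \<open>Cochains are extended by 0 outside \<open>L\<close>, so that equality of functions is equality of
  cochains.\<close>

definition CE_C1 :: "('k::field \<Rightarrow> 'v::ab_group_add \<Rightarrow> 'v) \<Rightarrow> 'v set \<Rightarrow> ('v \<Rightarrow> 'v) set" where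
  "CE_C1 s L =
     {f. (\<forall>x\<in>L. f x \<in> L) \<and> (\<forall>x\<in>L. \<forall>y\<in>L. f (x + y) = f x + f y) \<and>
         (\<forall>c. \<forall>x\<in>L. f (s c x) = s c (f x)) \<and> (\<forall>x. x \<notin> L \<longrightarrow> f x = 0)}"

definition CE_C2 :: "('k::field \<Rightarrow> 'v::ab_group_add \<Rightarrow> 'v) \<Rightarrow> 'v set \<Rightarrow> ('v \<Rightarrow> 'v \<Rightarrow> 'v) set" where
  "CE_C2 s L =
     {f. (\<forall>x\<in>L. \<forall>y\<in>L. f x y \<in> L) \<and>
         (\<forall>x\<in>L. \<forall>y\<in>L. \<forall>z\<in>L. f (x + y) z = f x z + f y z) \<and>
         (\<forall>x\<in>L. \<forall>y\<in>L. \<forall>z\<in>L. f x (y + z) = f x y + f x z) \<and>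
         (\<forall>c. \<forall>x\<in>L. \<forall>y\<in>L. f (s c x) y = s c (f x y)) \<and>
         (\<forall>c. \<forall>x\<in>L. \<forall>y\<in>L. f x (s c y) = s c (f x y)) \<and>
         (\<forall>x\<in>L. f x x = 0) \<and>
         (\<forall>x y. x \<notin> L \<or> y \<notin> L \<longrightarrow> f x y = 0)}"

definition CE_d1 ::
  "('v::ab_group_add \<Rightarrow> 'v \<Rightarrow> 'v) \<Rightarrow> ('v \<Rightarrow> 'v) \<Rightarrow> 'v \<Rightarrow> 'v \<Rightarrow> 'v" where
  "CE_d1 br f x y = br x (f y) - br y (f x) - f (br x y)"

definition CE_d2 ::
  "('v::ab_group_add \<Rightarrow> 'v \<Rightarrow> 'v) \<Rightarrow> ('v \<Rightarrow> 'v \<Rightarrow> 'v) \<Rightarrow> 'v \<Rightarrow> 'v \<Rightarrow> 'v \<Rightarrow> 'v" where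
  "CE_d2 br f x y z =
     br x (f y z) - br y (f x z) + br z (f x y)
     - f (br x y) z + f (br x z) y - f (br y z) x"

definition CE_Z2 ::
  "('k::field \<Rightarrow> 'v::ab_group_add \<Rightarrow> 'v) \<Rightarrow> 'v set \<Rightarrow> ('v \<Rightarrow> 'v \<Rightarrow> 'v) \<Rightarrow> ('v \<Rightarrow> 'v \<Rightarrow> 'v) set" where
  "CE_Z2 s L br = {f \<in> CE_C2 s L. \<forall>x\<in>L. \<forall>y\<in>L. \<forall>z\<in>L. CE_d2 br f x y z = 0}"

definition CE_B2 ::
  "('k::field \<Rightarrow> 'v::ab_group_add \<Rightarrow> 'v) \<Rightarrow> 'v set \<Rightarrow> ('v \<Rightarrow> 'v \<Rightarrow> 'v) \<Rightarrow> ('v \<Rightarrow> 'v \<Rightarrow> 'v) set" where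
  "CE_B2 s L br = {f \<in> CE_C2 s L. \<exists>g\<in>CE_C1 s L. \<forall>x\<in>L. \<forall>y\<in>L. f x y = CE_d1 br g x y}"

definition CE_H2 ::
  "('k::field \<Rightarrow> 'v::ab_group_add \<Rightarrow> 'v) \<Rightarrow> 'v set \<Rightarrow> ('v \<Rightarrow> 'v \<Rightarrow> 'v) \<Rightarrow> ('v \<Rightarrow> 'v \<Rightarrow> 'v) set set" where
  "CE_H2 s L br = CE_Z2 s L br //
     {(f, g). f \<in> CE_Z2 s L br \<and> g \<in> CE_Z2 s L br \<and> f - g \<in> CE_B2 s L br}"

text \<open>The zero class of the quotient is the space of coboundaries.\<close>

definition cohomologically_rigid ::
  "('k::field \<Rightarrow> 'v::ab_group_add \<Rightarrow> 'v) \<Rightarrow> 'v set \<Rightarrow> ('v \<Rightarrow> 'v \<Rightarrow> 'v) \<Rightarrow> bool" where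
  "cohomologically_rigid s L br \<longleftrightarrow> CE_H2 s L br = {CE_B2 s L br}"

section \<open>Well-formedness\<close>

lemma vector_space_fun_scale:
  assumes "vector_space s"
  shows "vector_space (fun_scale s)"
proof -
  interpret vector_space s by fact
  show ?thesis
    by unfold_locales (auto simp: fun_scale_def fun_eq_iff scale_right_distrib scale_left_distrib)
qed

lemma vector_space_semidirect_scale:
  assumes "vector_space s"
  shows "vector_space (semidirect_scale s)"
proof -
  interpret vector_space s by fact
  interpret F: vector_space "fun_scale s" using assms by (rule vector_space_fun_scale)
  show ?thesis
    by unfold_locales
      (auto simp: semidirect_scale_def scale_right_distrib scale_left_distrib
        F.scale_right_distrib F.scale_left_distrib prod_eq_iff)
qed

lemma (in lie_algebra) br_anti:
  assumes "x \<in> L" "y \<in> L" shows "br y x = - br x y"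
proof -
  have "x + y \<in> L" using assms subspace_carrier by (simp add: subspace_add)
  then have "br (x + y) (x + y) = 0" by (rule br_self)
  then have "br x x + br y x + (br x y + br y y) = 0"
    using assms \<open>x + y \<in> L\<close> by (simp add: br_add_left br_add_right ac_simps)
  then show ?thesis using assms by (simp add: br_self eq_neg_iff_add_eq_0 add.commute)
qed

lemma lie_algebra_semidirect:
  assumes "lie_algebra s UNIV br" and "torus s br T"
  shows "lie_algebra (semidirect_scale s) (semidirect_carrier T) (semidirect_bracket br)"
proof -
  interpret lie_algebra s UNIV br by fact
  interpret F: vector_space "fun_scale s"
    by (rule vector_space_fun_scale) (rule vector_space_axioms)
  interpret R: vector_space "semidirect_scale s"
    by (rule vector_space_semidirect_scale) (rule vector_space_axioms)
  have T: "F.subspace T" "\<And>x. x \<in> T \<Longrightarrow> Vector_Spaces.linear s s x"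
    "\<And>x u v. x \<in> T \<Longrightarrow> x (br u v) = br (x u) v + br u (x v)"
    "\<And>x y u. x \<in> T \<Longrightarrow> y \<in> T \<Longrightarrow> x (y u) = y (x u)"
    using assms(2) by (auto simp: torus_def derivations_def fun_eq_iff)
  have lin: "x (u + v) = x u + x v" "x (s c u) = s c (x u)" "x (u - v) = x u - x v"
    "x 0 = 0"  if "x \<in> T" for x u v c
  proof -
    interpret x: Vector_Spaces.linear s s x using T(2) that .
    show "x (u + v) = x u + x v" "x (s c u) = s c (x u)" "x (u - v) = x u - x v" "x 0 = 0"
      by (simp_all add: x.add x.scale x.diff x.zero)
  qed
  have br_diff: "br u (v - w) = br u v - br u w" for u v w
    using br_add_right[of u "v - w" w] by (simp add: algebra_simps)
  show ?thesis
  proof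
    show "R.subspace (semidirect_carrier T)"
      using T(1) by (auto simp: R.subspace_def F.subspace_def semidirect_carrier_def
          semidirect_scale_def zero_prod_def)
  next
    fix p q r assume "p \<in> semidirect_carrier T" "q \<in> semidirect_carrier T" "r \<in> semidirect_carrier T"
    then obtain u x v y w z where p: "p = (u, x)" "q = (v, y)" "r = (w, z)" and xyz: "x \<in> T" "y \<in> T" "z \<in> T"
      by (auto simp: semidirect_carrier_def)
    show "semidirect_bracket br p (semidirect_bracket br q r) +
        semidirect_bracket br q (semidirect_bracket br r p) +
        semidirect_bracket br r (semidirect_bracket br p q) = 0"
      using xyz jacobi[of u v w]
      by (simp add: p semidirect_bracket_def zero_prod_def lin T(3) br_add_right br_diff
          T(4)[of y x] T(4)[of z x] T(4)[of z y] br_anti[of "x v" w]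
          br_anti[of "x w" v] br_anti[of "y u" w] br_anti[of "y w" u] br_anti[of "z u" v] br_anti[of "z v" u])
  qed (use T(1) in \<open>auto simp: semidirect_bracket_def semidirect_carrier_def semidirect_scale_def
        fun_scale_def lin br_add_left br_add_right br_scale_left br_scale_right br_self
        F.subspace_0 zero_prod_def scale_right_distrib scale_right_diff_distrib algebra_simps\<close>)
qed

lemma (in lie_algebra) CE_B2_subset_Z2: "CE_B2 scale L br \<subseteq> CE_Z2 scale L br"
proof
  fix f assume "f \<in> CE_B2 scale L br"
  then obtain g where f: "f \<in> CE_C2 scale L" and gC: "g \<in> CE_C1 scale L"
    and fg: "\<And>x y. x \<in> L \<Longrightarrow> y \<in> L \<Longrightarrow> f x y = br x (g y) - br y (g x) - g (br x y)"
    by (auto simp: CE_B2_def CE_d1_def)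
  have g: "\<And>x. x \<in> L \<Longrightarrow> g x \<in> L" and gadd: "\<And>x y. x \<in> L \<Longrightarrow> y \<in> L \<Longrightarrow> g (x + y) = g x + g y"
    using gC by (auto simp: CE_C1_def)
  note sub = subspace_add[OF subspace_carrier] subspace_diff[OF subspace_carrier]
  have g_diff: "g (x - y) = g x - g y" if "x \<in> L" "y \<in> L" for x y
    using gadd[of "x - y" y] that sub by (simp add: algebra_simps)
  have br_diff: "br u (v - w) = br u v - br u w" if "u \<in> L" "v \<in> L" "w \<in> L" for u v w
    using br_add_right[of u "v - w" w] that sub by (simp add: algebra_simps)
  have J: "br (br u v) w = br u (br v w) - br v (br u w)" if "u \<in> L" "v \<in> L" "w \<in> L" for u v w
  proof -
    have "br v (br w u) = - br v (br u w)"
      using that br_anti[of u w] br_diff[of v 0 "br u w"] br_diff[of v 0 0]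
      by (simp add: br_closed subspace_0[OF subspace_carrier])
    moreover have "br (br u v) w = - br w (br u v)"
      using that br_anti[of w "br u v"] by (simp add: br_closed)
    moreover have "br w (br u v) = - br u (br v w) - br v (br w u)"
      using jacobi[OF that] by (metis add_diff_cancel_left' add.commute diff_0 diff_diff_eq)
    ultimately show ?thesis by simp
  qed
  have "CE_d2 br f x y z = 0" if xyz: "x \<in> L" "y \<in> L" "z \<in> L" for x y z
  proof -
    have "g (br (br x y) z) = g (br x (br y z)) - g (br y (br x z))"
      using xyz by (simp add: J br_closed g_diff)
    moreover have "g (br (br x z) y) = - g (br y (br x z))" "g (br (br y z) x) = - g (br x (br y z))"
      using xyz g_diff[of 0] g_diff[of 0 0] br_anti[of y "br x z"] br_anti[of x "br y z"]
      by (simp_all add: br_closed subspace_0[OF subspace_carrier])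
    ultimately show ?thesis using xyz
      by (simp add: CE_d2_def fg br_diff br_closed g sub J)
  qed
  with f show "f \<in> CE_Z2 scale L br" by (simp add: CE_Z2_def)
qed

end

theory Submission imports Defs begin

text \<open>
  Let \<open>x\<close> and \<open>y\<close> be weight vectors of weights \<open>\<alpha>\<^sub>1\<close> and \<open>\<alpha>\<^sub>2\<close> that generate the nilpotent algebra. Since
  \<open>3\<alpha>\<^sub>1 + \<alpha>\<^sub>2\<close> and \<open>\<alpha>\<^sub>1 + 3\<alpha>\<^sub>2\<close> are not weights, \<open>(ad x)\<^sup>3 y = 0 = (ad y)\<^sup>3 x\<close>. These are the Serre relations
  of affine \<open>sl\<^sub>2\<close>, and they force the Lie algebra generated by \<open>x\<close> and \<open>y\<close> to be spanned by one explicit root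
  vector, possibly zero, in each of the bidegrees \<open>(n+1, n)\<close>, \<open>(n, n+1)\<close>, \<open>(n+1, n+1)\<close> (locale \<open>serre_pair\<close>, lemmas
  \<open>root_relations\<close> and \<open>root_span_subalgebra\<close>). The algebra is thus determined by the set of its
  weights alone, and this persists in families: that is the source of rigidity.

  Indeed, let \<open>\<phi>\<close> be a 2-cocycle of the nilpotent algebra that is invariant under the torus. The bracket
  \<open>[u, v] + \<epsilon> \<phi>(u, v)\<close> with \<open>\<epsilon>\<^sup>2 = 0\<close> has the same weights, so the Serre relations still hold in it,
  and the subalgebra generated by \<open>x\<close> and \<open>y\<close> is a copy of the original algebra, namely the graph of a
  linear map. This map exhibits \<open>\<phi>\<close> as a coboundary (theorem \<open>invariant_cocycle_trivial\<close>).

  An arbitrary cocycle of the semidirect product is brought into this form by subtracting coboundaries.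
  An element of the torus acting by \<open>p + \<i> q\<close> in bidegree \<open>(p, q)\<close> acts semisimply on cochains and trivially on
  cohomology, so the cocycle may be taken homogeneous (lemma \<open>homogeneous_representative\<close>).
  By homogeneity its values on a torus element and a nilpotent one are given by derivations of degree
  zero, which already belong to the torus, so they can be removed as well
  (lemma \<open>normalize_torus_part\<close>).
\<close>

section \<open>Eigenvectors\<close>

context vector_space
begin

lemma eigenvectors_sum_zero:
  assumes D: "Vector_Spaces.linear scale scale D"
    and "finite F" "inj_on l F" "\<And>i. i \<in> F \<Longrightarrow> D (u i) = scale (l i) (u i)"
    and "(\<Sum>i\<in>F. u i) = 0" "i \<in> F"
  shows "u i = 0"
  using assms(2-)
proof (induction F arbitrary: u i rule: finite_induct)
  case (insert k F)
  interpret D: Vector_Spaces.linear scale scale D by (rule D)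
  have "0 = D (\<Sum>i\<in>insert k F. u i) - scale (l k) (\<Sum>i\<in>insert k F. u i)"
    using insert.prems(3) by (simp add: D.zero)
  also have "\<dots> = (\<Sum>i\<in>insert k F. scale (l i - l k) (u i))"
    unfolding D.sum scale_sum_right sum_subtractf[symmetric]
    by (rule sum.cong) (use insert.prems(2) in \<open>auto simp: scale_left_diff_distrib\<close>)
  also have "\<dots> = (\<Sum>i\<in>F. scale (l i - l k) (u i))"
    using insert.hyps by simp
  finally have sum: "(\<Sum>i\<in>F. scale (l i - l k) (u i)) = 0" by simp
  have "scale (l j - l k) (u j) = 0" if "j \<in> F" for j
  proof (rule insert.IH[OF _ _ sum that])
    show "inj_on l F" using insert.prems(1) by (simp add: inj_on_insert)
  next
    fix i assume "i \<in> F"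
    then show "D (scale (l i - l k) (u i)) = scale (l i) (scale (l i - l k) (u i))"
      using insert.prems(2)[of i] by (simp add: D.scale mult.commute)
  qed
  moreover have "l j \<noteq> l k" if "j \<in> F" for j
    using insert.prems(1) insert.hyps(2) that by (auto simp: inj_on_def)
  ultimately have u0: "u j = 0" if "j \<in> F" for j using that by fastforce
  then have "u k = 0" using insert.prems(3) insert.hyps by simp
  with u0 insert.prems(4) show ?case by auto
qed simp

lemma span_range_sum:
  assumes "u \<in> span (range v)"
  obtains F c where "finite F" "u = (\<Sum>i\<in>F. scale (c i) (v i))"
proof -
  let ?Q = "{u. \<exists>F c. finite F \<and> u = (\<Sum>i\<in>F. scale (c i) (v i))}"
  have "u \<in> ?Q"
    using assms
  proof (induction rule: span_induct_alt)
    case base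
    show ?case by (auto intro!: exI[of _ "{}"])
  next
    case (step a b w)
    then obtain i F c where b: "b = v i" and F: "finite F" "w = (\<Sum>i\<in>F. scale (c i) (v i))" by auto
    let ?c = "\<lambda>j. (if j = i then a else 0) + (if j \<in> F then c j else 0)"
    have "(\<Sum>j\<in>insert i F. scale (?c j) (v j)) =
        (\<Sum>j\<in>insert i F. if j = i then scale a (v j) else 0) +
        (\<Sum>j\<in>insert i F. if j \<in> F then scale (c j) (v j) else 0)"
      unfolding sum.distrib[symmetric] by (rule sum.cong) (auto simp: scale_left_distrib)
    also have "(\<Sum>j\<in>insert i F. if j = i then scale a (v j) else 0) = scale a b"
      using F(1) b by (simp add: sum.delta)
    also have "(\<Sum>j\<in>insert i F. if j \<in> F then scale (c j) (v j) else 0) = w"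
      unfolding F(2) by (rule sum.mono_neutral_cong_right) (use F(1) in auto)
    finally have "scale a b + w = (\<Sum>j\<in>insert i F. scale (?c j) (v j))" ..
    moreover have "finite (insert i F)" using F(1) by simp
    ultimately show ?case unfolding mem_Collect_eq by meson
  qed
  then show ?thesis using that by (elim CollectE exE conjE)
qed

text \<open>Expanding \<open>u\<close> in the eigenvectors \<open>v i\<close> and applying \<open>D - m\<close> scales the term at \<open>i\<close> by
  \<open>l i - m\<close>; the resulting terms have distinct eigenvalues and sum to zero, so each of them vanishes.\<close>

lemma eigenvector_in_span:
  assumes D: "Vector_Spaces.linear scale scale D"
    and v: "\<And>i. D (v i) = scale (l i) (v i)" and "inj l"
    and u: "u \<in> span (range v)" "D u = scale m u" "u \<noteq> 0"
  shows "\<exists>i c. m = l i \<and> u = scale c (v i)"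
proof -
  interpret D: Vector_Spaces.linear scale scale D by (rule D)
  obtain F c where F: "finite F" and uF: "u = (\<Sum>i\<in>F. scale (c i) (v i))"
    using span_range_sum[OF u(1)] .
  have "(\<Sum>i\<in>F. scale (l i - m) (scale (c i) (v i))) =
      (\<Sum>i\<in>F. D (scale (c i) (v i))) - (\<Sum>i\<in>F. scale m (scale (c i) (v i)))"
    unfolding sum_subtractf[symmetric] D.scale v
    by (intro sum.cong refl) (simp add: right_diff_distrib mult.commute flip: scale_left_diff_distrib)
  also have "\<dots> = 0"
    unfolding D.sum[symmetric] scale_sum_right[symmetric] uF[symmetric] using u(2) by simp
  finally have sum: "(\<Sum>i\<in>F. scale (l i - m) (scale (c i) (v i))) = 0" .
  have z: "scale (l i - m) (scale (c i) (v i)) = 0" if "i \<in> F" for i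
    by (rule eigenvectors_sum_zero[OF D F _ _ sum that, of l])
      (simp_all add: D.scale v mult_ac inj_on_subset[OF \<open>inj l\<close>])
  have "\<not> (\<forall>i\<in>F. scale (c i) (v i) = 0)"
    using u(3) sum.neutral[of F "\<lambda>i. scale (c i) (v i)"] unfolding uF by blast
  then obtain i where i: "i \<in> F" "scale (c i) (v i) \<noteq> 0" by blast
  then have m: "m = l i" using z[OF i(1)] unfolding scale_eq_0_iff[of "l i - m"] by simp
  have "scale (c j) (v j) = 0" if "j \<in> F - {i}" for j
    using z[of j] that m \<open>inj l\<close> by (auto simp: inj_eq)
  then have "(\<Sum>j\<in>F - {i}. scale (c j) (v j)) = 0" by (intro sum.neutral ballI)
  then have "u = scale (c i) (v i)"
    unfolding uF sum.remove[OF F i(1)] by simp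
  with m show ?thesis by blast
qed

text \<open>An eigenvector of \<open>D\<close> modulo an invariant subspace \<open>U\<close> lifts to a genuine one. For every eigenvalue
  \<open>n \<noteq> l\<close> of \<open>D\<close>, the map \<open>(D - n) / (l - n)\<close> kills the eigenspace of \<open>n\<close> and acts as the identity
  modulo \<open>U\<close> on vectors \<open>e\<close> with \<open>D e = l e\<close> modulo \<open>U\<close>; so applying these maps in turn gives the lift.
  As they are polynomials in \<open>D\<close>, they keep eigenvectors of maps commuting with \<open>D\<close>, which is what
  makes the lift usable for a whole torus.\<close>

lemma lift_eigenvector:
  assumes D: "Vector_Spaces.linear scale scale D" "diagonalizable scale D"
    and U: "subspace U" "\<And>u. u \<in> U \<Longrightarrow> D u \<in> U"
    and e: "D e - scale l e \<in> U"
  shows "\<exists>e'. e' - e \<in> U \<and> D e' = scale l e' \<and>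
    (\<forall>D' m. Vector_Spaces.linear scale scale D' \<longrightarrow> (\<forall>v. D' (D v) = D (D' v)) \<longrightarrow>
       D' e = scale m e \<longrightarrow> D' e' = scale m e')"
proof -
  interpret D: Vector_Spaces.linear scale scale D by (rule D)
  define E where "E = {v. D v = scale l v}"
  have sE: "subspace E"
    by (auto simp: E_def subspace_def D.zero D.add D.scale scale_right_distrib mult.commute)
  let ?R = "\<lambda>e e'. e' - e \<in> U \<and> D e' = scale l e' \<and> (\<forall>D' m. Vector_Spaces.linear scale scale D' \<longrightarrow>
      (\<forall>v. D' (D v) = D (D' v)) \<longrightarrow> D' e = scale m e \<longrightarrow> D' e' = scale m e')"
  have main: "\<exists>e'. ?R e e'"
    if "finite F" "\<forall>b\<in>F. \<exists>c. D b = scale c b" "e \<in> span (F \<union> E)" "D e - scale l e \<in> U" for F e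
    using that
  proof (induction F arbitrary: e rule: finite_induct)
    case empty
    then have "e \<in> E" using span_minimal[OF subset_refl sE] by auto
    then show ?case using subspace_0[OF U(1)] by (intro exI[of _ e]) (auto simp: E_def)
  next
    case (insert b F)
    obtain n where n: "D b = scale n b" using insert.prems(1) by auto
    obtain k where k: "e - scale k b \<in> span (F \<union> E)"
      using span_breakdown_eq[of e b "F \<union> E"] insert.prems(2) by auto
    show ?case
    proof (cases "n = l")
      case True
      then have "b \<in> E" by (simp add: E_def n)
      then have "e \<in> span (F \<union> E)"
        using span_add[OF k span_scale[OF span_base, of b _ k]] by simp
      with insert show ?thesis by auto
    next
      case False
      \<comment> \<open>Removes the component of \<open>e\<close> along \<open>b\<close> without changing \<open>e\<close> modulo \<open>U\<close>.\<close>
      define e1 where "e1 = scale (1 / (l - n)) (D e - scale n e)"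
      have stable: "D v \<in> span (F \<union> E)" if "v \<in> span (F \<union> E)" for v
        using that
      proof (induction rule: span_induct)
        case base
        show ?case
          by (auto simp: subspace_def D.zero D.add D.scale span_zero span_add span_scale)
      next
        case (step v)
        then obtain c where "D v = scale c v" using insert.prems(1) by (auto simp: E_def)
        with step show ?case by (metis span_base span_scale)
      qed
      have "D e - scale n e = D (e - scale k b) - scale n (e - scale k b)"
        by (simp add: D.diff D.scale n scale_right_diff_distrib mult.commute)
      also have "\<dots> \<in> span (F \<union> E)" using stable k by (simp add: span_diff span_scale)
      finally have e1: "e1 \<in> span (F \<union> E)" by (simp add: e1_def span_scale)
      have "e1 - e = scale (1 / (l - n)) ((D e - scale n e) - scale (l - n) e)"
        using False by (simp add: e1_def scale_right_diff_distrib)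
      also have "\<dots> = scale (1 / (l - n)) (D e - scale l e)"
        by (simp add: scale_left_diff_distrib)
      finally have e1e: "e1 - e \<in> U" using subspace_scale[OF U(1) insert.prems(3)] by simp
      have "D e1 - scale l e1 = scale (1 / (l - n)) (D (D e - scale l e) - scale n (D e - scale l e))"
        by (simp add: e1_def D.diff D.scale scale_right_diff_distrib mult_ac)
      also have "\<dots> \<in> U"
        using insert.prems(3) U by (simp add: subspace_diff subspace_scale)
      finally have "\<exists>e'. ?R e1 e'"
        using e1 insert.prems(1) by (intro insert.IH) auto
      then obtain e' where e': "?R e1 e'" ..
      have "e' - e \<in> U" using subspace_add[OF U(1) _ e1e, of "e' - e1"] e' by simp
      moreover have "D' e1 = scale m e1"
        if "Vector_Spaces.linear scale scale D'" "\<And>v. D' (D v) = D (D' v)" "D' e = scale m e" for D' m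
      proof -
        interpret D': Vector_Spaces.linear scale scale D' by fact
        show ?thesis
          using that(2,3) by (simp add: e1_def D'.diff D'.scale D.scale scale_right_diff_distrib mult_ac)
      qed
      ultimately show ?thesis using e' by blast
    qed
  qed
  obtain B where B: "span B = UNIV" "\<forall>b\<in>B. \<exists>c. D b = scale c b"
    using D(2) by (auto simp: diagonalizable_def)
  have "e \<in> {\<Sum>a\<in>t. scale (r a) a |t r. finite t \<and> t \<subseteq> B}"
    using B(1) span_explicit[of B] by auto
  then obtain F r where F: "finite F" "F \<subseteq> B" and eF: "e = (\<Sum>a\<in>F. scale (r a) a)"
    by (elim CollectE exE conjE)
  have "e \<in> span F" unfolding eF by (intro span_sum span_scale span_base)
  then show ?thesis
    using F B(2) e span_mono[of F "F \<union> E"] by (intro main[of F e]) auto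
qed

end

section \<open>Lie algebras in characteristic zero\<close>

locale char0_lie_algebra = lie_algebra scale UNIV br
  for scale :: "'k::field_char_0 \<Rightarrow> 'v::ab_group_add \<Rightarrow> 'v" (infixr "\<cdot>" 75)
    and br :: "'v \<Rightarrow> 'v \<Rightarrow> 'v"
begin

lemma br_linear_right: "Vector_Spaces.linear scale scale (br u)"
  by unfold_locales (auto simp: br_add_right br_scale_right algebra_simps)

lemma br_linear_left: "Vector_Spaces.linear scale scale (\<lambda>u. br u w)"
  by unfold_locales (auto simp: br_add_left br_scale_left algebra_simps)

lemma br_linear:
  "br u (v + w) = br u v + br u w" "br u (v - w) = br u v - br u w" "br u (- v) = - br u v"
  "br u 0 = 0" "br u (c \<cdot> v) = c \<cdot> br u v"
  "br (v + w) u = br v u + br w u" "br (v - w) u = br v u - br w u" "br (- v) u = - br v u"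
  "br 0 u = 0" "br (c \<cdot> v) u = c \<cdot> br v u"
proof -
  interpret right: Vector_Spaces.linear scale scale "br u" by (rule br_linear_right)
  interpret left: Vector_Spaces.linear scale scale "\<lambda>v. br v u" by (rule br_linear_left)
  show "br u (v + w) = br u v + br u w" "br u (v - w) = br u v - br u w" "br u (- v) = - br u v"
    "br u 0 = 0" "br u (c \<cdot> v) = c \<cdot> br u v"
    by (fact right.add right.diff right.neg right.zero right.scale)+
  show "br (v + w) u = br v u + br w u" "br (v - w) u = br v u - br w u" "br (- v) u = - br v u"
    "br 0 u = 0" "br (c \<cdot> v) u = c \<cdot> br v u"
    by (fact left.add left.diff left.neg left.zero left.scale)+
qed

lemma br_swap: "br v u = - br u v"
  by (rule br_anti) auto

lemma leibniz: "br u (br v w) = br (br u v) w + br v (br u w)"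
  using jacobi[of u v w] br_swap[of w u] br_swap[of w "br u v"]
  by (simp add: br_linear algebra_simps)

text \<open>Generators of a nilpotent Lie algebra modulo its derived algebra generate it: if \<open>S\<close> spans
  everything modulo the \<open>k\<close>-th term of the lower central series, then products of two elements lie in
  \<open>S\<close> modulo the next term, and the series ends at zero.\<close>

lemma subalgebra_eq_UNIV:
  assumes nil: "nilpotent_lie scale br"
    and S: "subspace S" "\<And>u w. u \<in> S \<Longrightarrow> w \<in> S \<Longrightarrow> br u w \<in> S"
    and gen: "\<And>u. \<exists>v\<in>S. u - v \<in> derived_subalgebra scale br"
  shows "S = UNIV"
proof -
  have *: "\<exists>v\<in>S. u - v \<in> lower_central scale br (Suc k)" for u k
  proof (induction k arbitrary: u)
    case 0
    then show ?case using S(1) subspace_0 by auto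
  next
    case (Suc k)
    let ?C = "lower_central scale br (Suc (Suc k))"
    have C: "?C = span {br a b |a b. a \<in> UNIV \<and> b \<in> lower_central scale br (Suc k)}"
      by (simp add: bracket_span_def)
    have brC: "br a b \<in> ?C" "br b a \<in> ?C" if "b \<in> lower_central scale br (Suc k)" for a b
    proof -
      show "br a b \<in> ?C" unfolding C by (rule span_base) (use that in auto)
      then show "br b a \<in> ?C"
        unfolding br_swap[of b a] C by (rule span_neg)
    qed
    let ?Q = "{u. \<exists>v\<in>S. u - v \<in> ?C}"
    have subC: "subspace ?C" unfolding C by (rule subspace_span)
    have Q: "subspace ?Q"
      unfolding subspace_def
    proof (intro conjI allI ballI)
      show "0 \<in> ?Q" using subspace_0[OF S(1)] subspace_0[OF subC] by force
    next
      fix u w assume "u \<in> ?Q" "w \<in> ?Q"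
      then obtain u' w' where "u' \<in> S" "w' \<in> S" "u - u' \<in> ?C" "w - w' \<in> ?C" by auto
      moreover have "(u + w) - (u' + w') = (u - u') + (w - w')" by simp
      ultimately show "u + w \<in> ?Q"
        using subspace_add[OF S(1)] subspace_add[OF subC] by (metis (no_types, lifting) mem_Collect_eq)
    next
      fix c u assume "u \<in> ?Q"
      then obtain u' where "u' \<in> S" "u - u' \<in> ?C" by auto
      then show "c \<cdot> u \<in> ?Q"
        using subspace_scale[OF S(1), of u' c] subspace_scale[OF subC, of "u - u'" c]
        by (auto simp: scale_right_diff_distrib simp del: lower_central.simps)
    qed
    have "br a b \<in> ?Q" for a b
    proof -
      obtain a' b' where a': "a' \<in> S" "a - a' \<in> lower_central scale br (Suc k)"
        and b': "b' \<in> S" "b - b' \<in> lower_central scale br (Suc k)"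
        using Suc.IH by meson
      have "br a b - br a' b' = br (a - a') b + br a' (b - b')"
        by (simp add: br_linear)
      also have "\<dots> \<in> ?C"
        using subspace_add[OF subC] brC a'(2) b'(2) by blast
      finally show ?thesis using S(2)[OF a'(1) b'(1)] by blast
    qed
    then have "derived_subalgebra scale br \<subseteq> ?Q"
      unfolding bracket_span_def by (intro span_minimal Q) auto
    moreover have "S \<subseteq> ?Q" using subspace_0[OF subC] by force
    moreover obtain v where "v \<in> S" "u - v \<in> derived_subalgebra scale br"
      using gen by blast
    ultimately have "v + (u - v) \<in> ?Q" using subspace_add[OF Q] by blast
    then show ?case by simp
  qed
  obtain k where "k \<ge> 1" "lower_central scale br k = {0}"
    using nil by (auto simp: nilpotent_lie_def)
  with *[of _ "k - 1"] show ?thesis by auto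
qed

lemma derivation_br_eigenvectors:
  assumes "d \<in> derivations scale br" "d u = a \<cdot> u" "d v = b \<cdot> v"
  shows "d (br u v) = (a + b) \<cdot> br u v"
  using assms by (simp add: derivations_def br_linear scale_left_distrib)

lemma subspace_derived: "subspace (derived_subalgebra scale br)"
  unfolding bracket_span_def by (rule subspace_span)

lemma derivation_derived:
  assumes "d \<in> derivations scale br" "u \<in> derived_subalgebra scale br"
  shows "d u \<in> derived_subalgebra scale br"
proof -
  interpret d: Vector_Spaces.linear scale scale d using assms(1) by (simp add: derivations_def)
  have br_in: "br a b \<in> derived_subalgebra scale br" for a b
    unfolding bracket_span_def by (rule span_base) auto
  show ?thesis
    using assms(2) unfolding bracket_span_def
  proof (induction rule: span_induct)
    case base
    show ?case by (auto simp: subspace_def d.zero d.add d.scale span_zero span_add span_scale)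
  next
    case (step u)
    then obtain a b where "u = br a b" by auto
    then have "d u = br (d a) b + br a (d b)" using assms(1) by (simp add: derivations_def)
    with br_in show ?case unfolding bracket_span_def by (simp add: span_add)
  qed
qed

text \<open>Weight vectors for the torus on the abelianization come from weight vectors in the algebra: lift for
  one element of a finite subset of the torus after the other.\<close>

lemma lift_weight_vector:
  assumes "torus scale br T" "finite B" "B \<subseteq> T"
    and "\<And>t. t \<in> T \<Longrightarrow> t e - \<alpha> t \<cdot> e \<in> derived_subalgebra scale br"
  shows "\<exists>e'. e' - e \<in> derived_subalgebra scale br \<and> (\<forall>t\<in>B. t e' = \<alpha> t \<cdot> e')"
  using assms(2,3)
proof (induction B rule: finite_induct)
  case empty
  then show ?case using subspace_0[OF subspace_derived] by (intro exI[of _ e]) simp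
next
  case (insert t B)
  let ?U = "derived_subalgebra scale br"
  obtain e1 where e1: "e1 - e \<in> ?U" "\<And>t'. t' \<in> B \<Longrightarrow> t' e1 = \<alpha> t' \<cdot> e1"
    using insert by auto
  have t: "t \<in> T" using insert.prems by simp
  have lin: "Vector_Spaces.linear scale scale t'" and der: "t' \<in> derivations scale br"
    and diag: "diagonalizable scale t'" if "t' \<in> T" for t'
    using assms(1) that by (auto simp: torus_def derivations_def)
  interpret t: Vector_Spaces.linear scale scale t by (rule lin[OF t])
  have "t e1 - \<alpha> t \<cdot> e1 = (t e - \<alpha> t \<cdot> e) + (t (e1 - e) - \<alpha> t \<cdot> (e1 - e))"
    by (simp add: t.diff scale_right_diff_distrib)
  also have "\<dots> \<in> ?U"
    using assms(4)[OF t] derivation_derived[OF der[OF t] e1(1)] e1(1) subspace_derived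
    by (simp add: subspace_add subspace_diff subspace_scale)
  finally have te1: "t e1 - \<alpha> t \<cdot> e1 \<in> ?U" .
  have "\<exists>e2. e2 - e1 \<in> ?U \<and> t e2 = \<alpha> t \<cdot> e2 \<and>
      (\<forall>D' m. Vector_Spaces.linear scale scale D' \<longrightarrow> (\<forall>v. D' (t v) = t (D' v)) \<longrightarrow>
         D' e1 = m \<cdot> e1 \<longrightarrow> D' e2 = m \<cdot> e2)"
    using lin[OF t] diag[OF t] subspace_derived derivation_derived[OF der[OF t]] te1
    by (rule lift_eigenvector)
  then obtain e2 where e2: "e2 - e1 \<in> ?U" "t e2 = \<alpha> t \<cdot> e2"
    and keep: "\<And>D' m. Vector_Spaces.linear scale scale D' \<Longrightarrow> (\<forall>v. D' (t v) = t (D' v)) \<Longrightarrow>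
       D' e1 = m \<cdot> e1 \<Longrightarrow> D' e2 = m \<cdot> e2"
    by (elim exE conjE) simp
  have "e2 - e \<in> ?U" using subspace_add[OF subspace_derived e2(1) e1(1)] by simp
  moreover have "t' e2 = \<alpha> t' \<cdot> e2" if "t' \<in> B" for t'
  proof (rule keep)
    have "t' \<in> T" using that insert.prems by auto
    then show "Vector_Spaces.linear scale scale t'" by (rule lin)
    show "\<forall>v. t' (t v) = t (t' v)"
      using assms(1) t \<open>t' \<in> T\<close> by (auto simp: torus_def fun_eq_iff)
    show "t' e1 = \<alpha> t' \<cdot> e1" using e1(2) that .
  qed
  ultimately show ?case using e2(2) by auto
qed

end

section \<open>Homogeneous cocycles\<close>

text \<open>Cut off outside \<open>L\<close> so that coboundaries are cochains and can be subtracted as functions.\<close>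

definition (in lie_algebra) coboundary :: "('v \<Rightarrow> 'v) \<Rightarrow> 'v \<Rightarrow> 'v \<Rightarrow> 'v" where
  "coboundary g x y = (if x \<in> L \<and> y \<in> L then CE_d1 br g x y else 0)"

context lie_algebra
begin

lemma L_closed:
  "0 \<in> L" "x \<in> L \<Longrightarrow> y \<in> L \<Longrightarrow> x + y \<in> L" "x \<in> L \<Longrightarrow> y \<in> L \<Longrightarrow> x - y \<in> L"
  "x \<in> L \<Longrightarrow> - x \<in> L" "x \<in> L \<Longrightarrow> scale c x \<in> L"
  by (simp_all add: subspace_0 subspace_add subspace_diff subspace_neg subspace_scale subspace_carrier)

lemma br_zero_on: "x \<in> L \<Longrightarrow> br x 0 = 0" "x \<in> L \<Longrightarrow> br 0 x = 0"
  using br_scale_right[of x 0 0] br_scale_left[of 0 x 0] L_closed(1) by simp_all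

lemma br_neg_on: "x \<in> L \<Longrightarrow> y \<in> L \<Longrightarrow> br x (- y) = - br x y"
  using br_scale_right[of x y "-1"] by simp

lemma br_diff_on: "x \<in> L \<Longrightarrow> y \<in> L \<Longrightarrow> z \<in> L \<Longrightarrow> br x (y - z) = br x y - br x z"
  using br_add_right[of x y "- z"] br_neg_on[of x z] L_closed by simp

lemma coboundary_in_B2:
  assumes "g \<in> CE_C1 scale L"
  shows "coboundary g \<in> CE_B2 scale L br"
proof -
  have g: "\<And>x. x \<in> L \<Longrightarrow> g x \<in> L" "\<And>x y. x \<in> L \<Longrightarrow> y \<in> L \<Longrightarrow> g (x + y) = g x + g y"
    "\<And>c x. x \<in> L \<Longrightarrow> g (scale c x) = scale c (g x)"
    using assms by (auto simp: CE_C1_def)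
  have "g 0 = 0" using g(3)[of 0 0] L_closed(1) by simp
  then have "coboundary g \<in> CE_C2 scale L"
    unfolding CE_C2_def
    by (auto simp: coboundary_def CE_d1_def br_closed g L_closed br_add_left br_add_right
        br_scale_left br_scale_right br_self scale_right_diff_distrib)
  then show ?thesis using assms by (auto simp: CE_B2_def coboundary_def)
qed

lemma cochain_swap:
  assumes f: "f \<in> CE_C2 scale L" and xy: "x \<in> L" "y \<in> L"
  shows "f y x = - f x y"
proof -
  have add: "f (u + v) w = f u w + f v w" "f w (u + v) = f w u + f w v"
    if "u \<in> L" "v \<in> L" "w \<in> L" for u v w
    using f that by (auto simp: CE_C2_def)
  have "f (x + y) (x + y) = f x x + f y x + (f x y + f y y)"
    unfolding add(2)[OF xy L_closed(2)[OF xy]] using xy by (simp only: add)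
  moreover have "f v v = 0" if "v \<in> L" for v using f that by (auto simp: CE_C2_def)
  ultimately show ?thesis using xy L_closed(2)[OF xy] by (simp add: eq_neg_iff_add_eq_0)
qed

lemma CE_Z2_diff:
  assumes "f \<in> CE_Z2 scale L br" "h \<in> CE_Z2 scale L br"
  shows "f - h \<in> CE_Z2 scale L br"
proof -
  have in_L: "f x y \<in> L" "h x y \<in> L" if "x \<in> L" "y \<in> L" for x y
    using assms that by (auto simp: CE_Z2_def CE_C2_def)
  have C2: "f - h \<in> CE_C2 scale L"
    using assms unfolding CE_Z2_def CE_C2_def
    by (auto simp: L_closed scale_right_diff_distrib)
  have "CE_d2 br (f - h) x y z = CE_d2 br f x y z - CE_d2 br h x y z"
    if "x \<in> L" "y \<in> L" "z \<in> L" for x y z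
    using that by (simp add: CE_d2_def br_diff_on in_L br_closed)
  with C2 assms show ?thesis by (simp add: CE_Z2_def)
qed

lemma diff_coboundary_in_Z2:
  assumes "f \<in> CE_Z2 scale L br" "g \<in> CE_C1 scale L"
  shows "f - coboundary g \<in> CE_Z2 scale L br"
  using CE_Z2_diff assms coboundary_in_B2 CE_B2_subset_Z2 by blast

lemma in_B2_if_diff_coboundary_in_B2:
  assumes "f - coboundary g \<in> CE_B2 scale L br" "g \<in> CE_C1 scale L"
  shows "f \<in> CE_B2 scale L br"
proof -
  obtain g' where C2: "f - coboundary g \<in> CE_C2 scale L" and g': "g' \<in> CE_C1 scale L"
    and eq: "\<And>x y. x \<in> L \<Longrightarrow> y \<in> L \<Longrightarrow> (f - coboundary g) x y = CE_d1 br g' x y"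
    using assms(1) by (auto simp: CE_B2_def)
  have sum: "g + g' \<in> CE_C1 scale L"
    using assms(2) g' by (auto simp: CE_C1_def L_closed scale_right_distrib)
  have in_L: "g x \<in> L" "g' x \<in> L" if "x \<in> L" for x
    using that assms(2) g' by (auto simp: CE_C1_def)
  have f: "f x y = (if x \<in> L \<and> y \<in> L then CE_d1 br (g + g') x y else 0)" for x y
  proof (cases "x \<in> L \<and> y \<in> L")
    case True
    then show ?thesis
      using eq[of x y] in_L by (simp add: coboundary_def CE_d1_def br_add_right diff_eq_eq algebra_simps)
  next
    case False
    then show ?thesis using C2 by (auto simp: CE_C2_def coboundary_def)
  qed
  then have "f = coboundary (g + g')" by (simp add: fun_eq_iff coboundary_def)
  then show ?thesis using coboundary_in_B2[OF sum] by simp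
qed

lemma cohomologically_rigidI:
  assumes "CE_Z2 scale L br \<subseteq> CE_B2 scale L br"
  shows "cohomologically_rigid scale L br"
proof -
  have B: "CE_B2 scale L br = CE_Z2 scale L br" using assms CE_B2_subset_Z2 by blast
  have "(\<lambda>x. 0) \<in> CE_C1 scale L" by (simp add: CE_C1_def L_closed)
  from coboundary_in_B2[OF this] have ne: "CE_Z2 scale L br \<noteq> {}" using B by auto
  show ?thesis
    unfolding cohomologically_rigid_def CE_H2_def quotient_def B
    using ne by (auto simp: CE_Z2_diff)
qed

text \<open>If \<open>ad t\<close> is diagonalizable on \<open>L\<close>, then \<open>ad t - l\<close> is invertible on the sum of the eigenspaces of
  the other eigenvalues, so the equation \<open>[t, w] - l w = u\<close> is solvable up to an error in the eigenspace
  of \<open>l\<close>.\<close>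

lemma solve_ad_modulo_eigenspace:
  assumes "t \<in> L" and span: "L \<subseteq> span {v \<in> L. \<exists>l. br t v = scale l v}" and "u \<in> L"
  obtains w where "w \<in> L" "br t (br t w - scale l w - u) = scale l (br t w - scale l w - u)"
proof -
  let ?R = "{u \<in> L. \<exists>w\<in>L. br t (br t w - scale l w - u) = scale l (br t w - scale l w - u)}"
  have "subspace ?R"
    unfolding subspace_def
  proof (intro conjI ballI allI)
    show "0 \<in> ?R" using \<open>t \<in> L\<close> by (auto simp: L_closed br_zero_on intro!: bexI[of _ 0])
  next
    fix u u' assume "u \<in> ?R" "u' \<in> ?R"
    then obtain w w' where w: "u \<in> L" "w \<in> L" "br t (br t w - scale l w - u) = scale l (br t w - scale l w - u)"
      and w': "u' \<in> L" "w' \<in> L" "br t (br t w' - scale l w' - u') = scale l (br t w' - scale l w' - u')"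
      by auto
    have eq: "br t (w + w') - scale l (w + w') - (u + u') = (br t w - scale l w - u) + (br t w' - scale l w' - u')"
      using w(1,2) w'(1,2) \<open>t \<in> L\<close> by (simp add: br_add_right scale_right_distrib algebra_simps)
    have "br t (br t (w + w') - scale l (w + w') - (u + u')) = scale l (br t (w + w') - scale l (w + w') - (u + u'))"
      unfolding eq using w w' \<open>t \<in> L\<close>
      by (simp add: br_add_right br_closed L_closed scale_right_distrib)
    with w w' show "u + u' \<in> ?R" by (auto simp: L_closed)
  next
    fix c u assume "u \<in> ?R"
    then obtain w where w: "u \<in> L" "w \<in> L" "br t (br t w - scale l w - u) = scale l (br t w - scale l w - u)"
      by auto
    have eq: "br t (scale c w) - scale l (scale c w) - scale c u = scale c (br t w - scale l w - u)"
      using w \<open>t \<in> L\<close> by (simp add: br_scale_right scale_right_diff_distrib mult.commute)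
    have "br t (br t (scale c w) - scale l (scale c w) - scale c u) =
        scale l (br t (scale c w) - scale l (scale c w) - scale c u)"
      unfolding eq using w \<open>t \<in> L\<close>
      by (simp add: br_scale_right br_closed L_closed mult.commute)
    with w show "scale c u \<in> ?R" by (auto simp only: mem_Collect_eq L_closed)
  qed
  moreover have "{v \<in> L. \<exists>m. br t v = scale m v} \<subseteq> ?R"
  proof
    fix v assume "v \<in> {v \<in> L. \<exists>m. br t v = scale m v}"
    then obtain m where v: "v \<in> L" "br t v = scale m v" by auto
    show "v \<in> ?R"
    proof (cases "m = l")
      case True
      with v \<open>t \<in> L\<close> show ?thesis
        by (auto simp: L_closed br_zero_on br_neg_on intro!: bexI[of _ 0])
    next
      case False
      define w where "w = scale (1 / (m - l)) v"
      have w: "w \<in> L" using v by (simp add: w_def L_closed)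
      have "br t w - scale l w = scale ((m - l) / (m - l)) v"
        unfolding w_def using v \<open>t \<in> L\<close>
        by (simp add: br_scale_right flip: scale_left_diff_distrib diff_divide_distrib)
      then have "br t w - scale l w - v = 0" using False by simp
      with v w \<open>t \<in> L\<close> show ?thesis by (auto simp: br_zero_on intro!: bexI[of _ w])
    qed
  qed
  ultimately have "L \<subseteq> ?R" using span span_minimal by blast
  with \<open>u \<in> L\<close> that show ?thesis by auto
qed

lemma ad_eigenvector_sum:
  assumes t: "t \<in> L" and "finite F" "F \<subseteq> L" "\<And>b. b \<in> F \<Longrightarrow> br t b = scale (k b) b"
  shows "(\<Sum>b\<in>F. scale (r b) b) \<in> L \<and>
    br t (\<Sum>b\<in>F. scale (r b) b) - scale l (\<Sum>b\<in>F. scale (r b) b) = (\<Sum>b\<in>F. scale (r b * (k b - l)) b)"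
  using assms(2-)
proof (induction F rule: finite_induct)
  case empty
  then show ?case using t by (simp add: L_closed br_zero_on)
next
  case (insert b F)
  let ?u = "\<Sum>b\<in>F. scale (r b) b"
  have IH: "?u \<in> L" "br t ?u - scale l ?u = (\<Sum>b\<in>F. scale (r b * (k b - l)) b)"
    using insert by auto
  have b: "b \<in> L" "br t b = scale (k b) b" using insert.prems by auto
  have "br t (scale (r b) b) - scale l (scale (r b) b) = scale (r b * (k b - l)) b"
    using b t by (simp add: br_scale_right right_diff_distrib mult.commute flip: scale_left_diff_distrib)
  moreover have "br t (scale (r b) b + ?u) - scale l (scale (r b) b + ?u) =
      (br t (scale (r b) b) - scale l (scale (r b) b)) + (br t ?u - scale l ?u)"
    using b t IH(1) by (simp add: br_add_right L_closed scale_right_distrib)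
  ultimately show ?case
    unfolding sum.insert[OF insert.hyps] IH(2) using b IH(1) by (auto intro!: L_closed)
qed

text \<open>Semisimplicity of \<open>ad t\<close>: expand \<open>u\<close> in an eigenbasis, where \<open>(ad t - l)\<^sup>2\<close> and \<open>ad t - l\<close> kill the same
  basis vectors.\<close>

lemma ad_generalized_eigenvector:
  assumes t: "t \<in> L" and span: "L \<subseteq> span {v \<in> L. \<exists>l. br t v = scale l v}" and u: "u \<in> L"
    and gen: "br t (br t u - scale l u) = scale l (br t u - scale l u)"
  shows "br t u = scale l u"
proof -
  let ?E = "{v \<in> L. \<exists>l. br t v = scale l v}"
  obtain B where B: "B \<subseteq> ?E" "independent B" "?E \<subseteq> span B"
    using maximal_independent_subset .
  have "u \<in> span B" using span u span_minimal[OF B(3) subspace_span] by auto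
  then have "u \<in> {\<Sum>a\<in>F. scale (r a) a |F r. finite F \<and> F \<subseteq> B}"
    unfolding span_explicit[of B] .
  then obtain F r where F: "finite F" "F \<subseteq> B" and uF: "u = (\<Sum>a\<in>F. scale (r a) a)"
    by (elim CollectE exE conjE)
  have FE: "F \<subseteq> ?E" using F(2) B(1) by (rule subset_trans)
  have FL: "F \<subseteq> L" using FE by auto
  have "\<forall>b\<in>F. \<exists>k. br t b = scale k b" using FE by auto
  then obtain k where k: "\<And>b. b \<in> F \<Longrightarrow> br t b = scale (k b) b" by metis
  have first: "br t u - scale l u = (\<Sum>b\<in>F. scale (r b * (k b - l)) b)"
    unfolding uF using ad_eigenvector_sum[OF t F(1) FL, of k] k by blast
  have second: "br t (br t u - scale l u) - scale l (br t u - scale l u) =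
      (\<Sum>b\<in>F. scale (r b * (k b - l) * (k b - l)) b)"
    unfolding first using ad_eigenvector_sum[OF t F(1) FL, of k "\<lambda>b. r b * (k b - l)" l] k by blast
  have "(\<Sum>b\<in>F. scale (r b * (k b - l) * (k b - l)) b) = 0"
    unfolding second[symmetric] using gen by simp
  then have "r b * (k b - l) * (k b - l) = 0" if "b \<in> F" for b
    using independentD[OF B(2) F(1,2), of "\<lambda>b. r b * (k b - l) * (k b - l)"] that by blast
  then have "r b * (k b - l) = 0" if "b \<in> F" for b using that by fastforce
  then have "br t u - scale l u = 0" unfolding first by (intro sum.neutral ballI) simp
  then show ?thesis by simp
qed

text \<open>An inner derivation acts trivially on cohomology: with the Lie derivative \<open>L_t\<close> and the contraction
  \<open>i_t\<close> on cochains, \<open>L_t = d \<circ> i_t + i_t \<circ> d\<close>. So if \<open>ad t\<close> is diagonalizable, every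
  cocycle \<open>f\<close> is cohomologous to one of weight zero. Concretely, \<open>g\<close> is chosen on an eigenbasis such that
  subtracting its coboundary removes from \<open>i_t f = f t\<close> all components that change the eigenvalue. For
  the new cocycle \<open>F\<close> the map \<open>i_t F\<close> then commutes with \<open>ad t\<close>, so \<open>L_t F = d (i_t F)\<close> has weight zero,
  that is \<open>L_t (L_t F) = 0\<close>; by semisimplicity \<open>L_t F = 0\<close>.\<close>

lemma homogeneous_representative:
  assumes t: "t \<in> L" and span: "L \<subseteq> span {v \<in> L. \<exists>l. br t v = scale l v}"
    and f: "f \<in> CE_Z2 scale L br"
  obtains g where "g \<in> CE_C1 scale L"
    "\<And>v w l m. \<lbrakk>v \<in> L; w \<in> L; br t v = scale l v; br t w = scale m w\<rbrakk> \<Longrightarrow>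
       br t ((f - coboundary g) v w) = scale (l + m) ((f - coboundary g) v w)"
proof -
  let ?E = "{v \<in> L. \<exists>l. br t v = scale l v}"
  obtain B where B: "B \<subseteq> ?E" "independent B" "?E \<subseteq> span B"
    using maximal_independent_subset .
  have spanB: "span B = L"
  proof
    show "span B \<subseteq> L" using B(1) by (intro span_minimal subspace_carrier) auto
    show "L \<subseteq> span B" using span span_minimal[OF B(3) subspace_span] by auto
  qed
  have f_L: "f v w \<in> L" if "v \<in> L" "w \<in> L" for v w
    using f that by (auto simp: CE_Z2_def CE_C2_def)
  have f_lin: "f t (v + w) = f t v + f t w" "f t (scale c v) = scale c (f t v)"
    if "v \<in> L" "w \<in> L" for v w c
    using f that t by (auto simp: CE_Z2_def CE_C2_def)
  have "\<forall>b\<in>B. \<exists>l w. br t b = scale l b \<and> w \<in> L \<and>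
      br t (br t w - scale l w - f t b) = scale l (br t w - scale l w - f t b)"
  proof
    fix b assume "b \<in> B"
    then obtain l where b: "b \<in> L" "br t b = scale l b" using B(1) by auto
    obtain w where "w \<in> L" "br t (br t w - scale l w - f t b) = scale l (br t w - scale l w - f t b)"
      using solve_ad_modulo_eigenspace[OF t span f_L[OF t b(1)]] .
    with b show "\<exists>l w. br t b = scale l b \<and> w \<in> L \<and>
      br t (br t w - scale l w - f t b) = scale l (br t w - scale l w - f t b)" by blast
  qed
  then obtain k w where kw: "\<And>b. b \<in> B \<Longrightarrow> br t b = scale (k b) b" "\<And>b. b \<in> B \<Longrightarrow> w b \<in> L"
    "\<And>b. b \<in> B \<Longrightarrow> br t (br t (w b) - scale (k b) (w b) - f t b) =
       scale (k b) (br t (w b) - scale (k b) (w b) - f t b)"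
    by metis
  interpret P: vector_space_pair scale scale by unfold_locales
  define g where "g v = (if v \<in> L then P.construct B w v else 0)" for v
  interpret c: Vector_Spaces.linear scale scale "P.construct B w"
    by (rule P.linear_construct[OF B(2)])
  have g_L: "g v \<in> L" for v
  proof -
    have "span (w ` B) \<subseteq> L" using kw(2) by (intro span_minimal subspace_carrier) auto
    with P.construct_in_span[OF B(2), of w v] show ?thesis by (auto simp: g_def L_closed)
  qed
  have g_lin: "g (v + v') = g v + g v'" "g (scale c v) = scale c (g v)"
    if "v \<in> L" "v' \<in> L" for v v' c
    using that by (simp_all add: g_def L_closed c.add c.scale)
  have g_C1: "g \<in> CE_C1 scale L"
    using g_lin by (auto simp: CE_C1_def g_L) (simp add: g_def)
  have g_B: "g b = w b" if "b \<in> B" for b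
    using that B(1) P.construct_basis[OF B(2) that, of w] by (auto simp: g_def)
  define F where "F = f - coboundary g"
  have F_Z2: "F \<in> CE_Z2 scale L br"
    unfolding F_def using f g_C1 by (rule diff_coboundary_in_Z2)
  have F_L: "F v w \<in> L" if "v \<in> L" "w \<in> L" for v w
    using F_Z2 that by (auto simp: CE_Z2_def CE_C2_def)
  \<comment> \<open>Up to sign and the inner derivation by \<open>g t\<close>, this is the contraction of \<open>F\<close> with \<open>t\<close>.\<close>
  define \<Psi> where "\<Psi> v = br t (g v) - g (br t v) - f t v" for v
  have \<Psi>_L: "\<Psi> v \<in> L" if "v \<in> L" for v
    using that t by (simp add: \<Psi>_def L_closed br_closed g_L f_L)
  have \<Psi>_lin: "\<Psi> (v + v') = \<Psi> v + \<Psi> v'" "\<Psi> (scale c v) = scale c (\<Psi> v)"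
    if "v \<in> L" "v' \<in> L" for v v' c
    using that t
    by (simp_all add: \<Psi>_def br_add_right br_scale_right g_lin g_L f_lin br_closed scale_right_diff_distrib)
  have \<Psi>_ad: "br t (\<Psi> v) = \<Psi> (br t v)" if "v \<in> L" for v
  proof -
    let ?K = "{v \<in> L. br t (\<Psi> v) = \<Psi> (br t v)}"
    have "\<Psi> 0 = 0" using \<Psi>_lin(2)[of 0 0 0] L_closed(1) by simp
    then have "subspace ?K"
      using t by (auto simp: subspace_def L_closed \<Psi>_lin \<Psi>_L br_add_right br_scale_right br_closed br_zero_on)
    moreover have "B \<subseteq> ?K"
    proof
      fix b assume b: "b \<in> B"
      then have bL: "b \<in> L" using B(1) by auto
      have "\<Psi> b = br t (w b) - scale (k b) (w b) - f t b"
        using b bL by (simp add: \<Psi>_def kw(1) g_lin g_B)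
      then have "br t (\<Psi> b) = scale (k b) (\<Psi> b)" using kw(3)[OF b] by simp
      with b bL show "b \<in> ?K" by (simp add: kw(1) \<Psi>_lin)
    qed
    ultimately have "L \<subseteq> ?K" using spanB span_minimal by blast
    with that show ?thesis by auto
  qed
  \<comment> \<open>The inner derivation by \<open>g t\<close> is harmless, because \<open>g t\<close> commutes with \<open>t\<close>.\<close>
  have gt: "br t (g t) \<in> L \<and> br t (br t (g t)) = 0"
  proof -
    have "f t t = 0" using f t by (auto simp: CE_Z2_def CE_C2_def)
    moreover have "g 0 = 0" by (simp add: g_def c.zero)
    ultimately have "\<Psi> t = br t (g t)" by (simp add: \<Psi>_def br_self t)
    moreover have "\<Psi> 0 = 0" using \<Psi>_lin(2)[of 0 0 0] L_closed(1) by simp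
    ultimately show ?thesis using \<Psi>_ad[OF t] t by (simp add: br_self br_closed g_L)
  qed
  then have gt0: "br t (g t) = 0"
    using ad_generalized_eigenvector[OF t span g_L, of t 0] by simp
  have leib: "br t (br v w) = br (br t v) w + br v (br t w)" if "v \<in> L" "w \<in> L" for v w
  proof -
    have "br w (br t v) = - br (br t v) w" using br_anti[of "br t v" w] t that br_closed by blast
    moreover have "br v (br w t) = - br v (br t w)"
      using br_anti[of t w] t that by (simp add: br_neg_on br_closed)
    ultimately show ?thesis using jacobi[OF t that] by (simp add: algebra_simps)
  qed
  have Ft: "F t v = br v (g t) - \<Psi> v" if "v \<in> L" for v
    using that t by (simp add: F_def coboundary_def CE_d1_def \<Psi>_def)
  have Ft_ad: "br t (F t v) = F t (br t v)" if "v \<in> L" for v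
    using that t by (simp add: Ft br_diff_on br_closed g_L \<Psi>_L leib gt0 \<Psi>_ad br_zero_on)
  have "br t (F v w) = scale (l + m) (F v w)"
    if vw: "v \<in> L" "w \<in> L" and eig: "br t v = scale l v" "br t w = scale m w" for v w l m
  proof (rule ad_generalized_eigenvector[OF t span F_L[OF vw]])
    have F_bil: "F (scale l v) w = scale l (F v w)" "F (scale m w) v = scale m (F w v)"
      "F t (scale l v) = scale l (F t v)" "F t (scale m w) = scale m (F t w)"
      "F t (br t (br v w)) = scale (l + m) (F t (br v w))"
      using F_Z2 vw t
      by (auto simp: CE_Z2_def CE_C2_def leib eig br_scale_left br_scale_right br_closed
          simp flip: scale_left_distrib)
    have F_anti: "F b a = - F a b" if "a \<in> L" "b \<in> L" for a b
      using F_Z2 that cochain_swap by (auto simp: CE_Z2_def)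
    \<comment> \<open>The coboundary of the contraction of \<open>F\<close> with \<open>t\<close>, evaluated at \<open>v\<close> and \<open>w\<close>.\<close>
    let ?z = "br v (F t w) - br w (F t v) - F t (br v w)"
    have "CE_d2 br F t v w = 0" using F_Z2 t vw by (auto simp: CE_Z2_def)
    then have "br t (F v w) - br v (F t w) + br w (F t v) - scale l (F v w) + scale m (F w v) - F (br v w) t = 0"
      by (simp add: CE_d2_def eig F_bil)
    then have z: "br t (F v w) - scale (l + m) (F v w) = ?z"
      using F_anti[of v w] F_anti[of t "br v w"] vw t
      by (simp add: br_closed scale_left_distrib algebra_simps)
    have "br t ?z = scale (l + m) ?z"
    proof -
      have "br t (br v (F t w)) = scale (l + m) (br v (F t w))"
        using vw t by (simp add: leib F_L Ft_ad eig F_bil br_scale_left br_scale_right scale_left_distrib)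
      moreover have "br t (br w (F t v)) = scale (l + m) (br w (F t v))"
        using vw t by (simp add: leib F_L Ft_ad eig F_bil br_scale_left br_scale_right scale_left_distrib)
      moreover have "br t (F t (br v w)) = scale (l + m) (F t (br v w))"
        using vw t by (simp add: Ft_ad br_closed F_bil)
      ultimately show ?thesis
        using vw t by (simp add: br_diff_on F_L br_closed L_closed scale_right_diff_distrib)
    qed
    then show "br t (br t (F v w) - scale (l + m) (F v w)) =
        scale (l + m) (br t (F v w) - scale (l + m) (F v w))"
      unfolding z .
  qed
  with g_C1 show ?thesis unfolding F_def by (rule that)
qed

end

section \<open>Consequences of the Serre relations\<close>

text \<open>
  The two relations are the Serre relations of affine \<open>sl\<^sub>2\<close>, whose positive part is the
  subalgebra of the loop algebra of \<open>sl\<^sub>2\<close> generated by \<open>E\<close> and \<open>t F\<close>. The vectors \<open>e_root n\<close>,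
  \<open>f_root n\<close> and \<open>h_root n\<close> below play the roles of \<open>t\<^sup>n E\<close>, \<open>t\<^sup>n\<^sup>+\<^sup>1 F\<close> and \<open>t\<^sup>n\<^sup>+\<^sup>1 H\<close>; the factors \<open>1/2\<close>
  and \<open>-1/2\<close> undo those of \<open>[H, E] = 2 E\<close> and \<open>[H, F] = -2 F\<close>. Some of them may vanish, as only a
  quotient of the positive part need be present.
\<close>

locale serre_pair = char0_lie_algebra scale br
  for scale :: "'k::field_char_0 \<Rightarrow> 'v::ab_group_add \<Rightarrow> 'v" (infixr "\<cdot>" 75)
    and br :: "'v \<Rightarrow> 'v \<Rightarrow> 'v" +
  fixes x y :: 'v
  assumes serre_x: "br x (br x (br x y)) = 0"
    and serre_y: "br y (br y (br y x)) = 0"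
begin

primrec e_root :: "nat \<Rightarrow> 'v" where
  "e_root 0 = x"
| "e_root (Suc n) = (1/2) \<cdot> br (br x y) (e_root n)"

primrec f_root :: "nat \<Rightarrow> 'v" where
  "f_root 0 = y"
| "f_root (Suc n) = (- 1/2) \<cdot> br (br x y) (f_root n)"

definition h_root :: "nat \<Rightarrow> 'v" where
  "h_root n = br (e_root n) y"

lemma h_root_0: "h_root 0 = br x y"
  by (simp add: h_root_def)

lemma h0_e: "br (h_root 0) (e_root n) = 2 \<cdot> e_root (Suc n)"
  by (simp add: h_root_0)

lemma h0_f: "br (h_root 0) (f_root n) = (-2) \<cdot> f_root (Suc n)"
  by (simp add: h_root_0)

text \<open>The step from level \<open>m + 1\<close> to level \<open>m + 2\<close> in proving that all \<open>e_root i\<close> commute, or all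
  \<open>f_root i\<close>. Applying \<open>ad (h_root 0)\<close> to the relations of level \<open>m + 1\<close> shows that \<open>[u i, u j]\<close> changes
  sign when one unit is shifted from \<open>i\<close> to \<open>j\<close>. Applying \<open>ad (h_root 1)\<close> to those of level \<open>m\<close> shows that
  it also changes sign when two units are shifted at once. Shifting them one after the other restores the
  sign, so the bracket is its own negative.\<close>

lemma commuting_next_level:
  assumes ad0: "\<And>i. br (h_root 0) (u i) = c \<cdot> u (Suc i)"
    and ad1: "\<And>i. br (h_root 1) (u i) = c \<cdot> u (Suc (Suc i))"
    and "c \<noteq> 0"
    and lvl: "\<And>i j. i + j \<le> Suc m \<Longrightarrow> br (u i) (u j) = 0"
    and "i + j = Suc (Suc m)"
  shows "br (u i) (u j) = 0"
proof -
  have D0: "br (u (Suc i)) (u j) = - br (u i) (u (Suc j))" if "i + j = Suc m" for i j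
  proof -
    have "0 = br (h_root 0) (br (u i) (u j))" using lvl[of i j] that by (simp add: br_linear)
    also have "\<dots> = c \<cdot> (br (u (Suc i)) (u j) + br (u i) (u (Suc j)))"
      by (simp add: leibniz[of "h_root 0"] ad0 br_linear scale_right_distrib)
    finally show ?thesis using \<open>c \<noteq> 0\<close> by (simp add: eq_neg_iff_add_eq_0)
  qed
  have D1: "br (u (Suc (Suc i))) (u j) = - br (u i) (u (Suc (Suc j)))" if "i + j = m" for i j
  proof -
    have "0 = br (h_root 1) (br (u i) (u j))" using lvl[of i j] that by (simp add: br_linear)
    also have "\<dots> = c \<cdot> (br (u (Suc (Suc i))) (u j) + br (u i) (u (Suc (Suc j))))"
      unfolding leibniz[of "h_root 1"] ad1 by (simp add: br_linear scale_right_distrib)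
    finally show ?thesis using \<open>c \<noteq> 0\<close> by (simp add: eq_neg_iff_add_eq_0)
  qed
  have ge2: "br (u i) (u (Suc (Suc j))) = 0" if "i + j = m" for i j
  proof -
    have "br (u i) (u (Suc (Suc j))) = - br (u i) (u (Suc (Suc j)))"
      using D0[of "Suc i" j] D0[of i "Suc j"] D1[of i j] that by simp
    then have "2 \<cdot> br (u i) (u (Suc (Suc j))) = 0"
      by (simp add: eq_neg_iff_add_eq_0 scale_left_distrib[of 1 1, simplified])
    then show ?thesis by simp
  qed
  show ?thesis
  proof (cases j)
    case 0
    with assms(5) ge2[of 0 m] br_swap[of "u i" "u j"] show ?thesis by simp
  next
    case (Suc j')
    show ?thesis
    proof (cases j')
      case 0
      with Suc assms(5) ge2[of m 0] D0[of m 1] show ?thesis by simp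
    next
      case (Suc j'')
      with \<open>j = Suc j'\<close> assms(5) ge2[of i j''] show ?thesis by simp
    qed
  qed
qed

lemma x_h:
  assumes "br x (e_root n) = 0"
  shows "br x (h_root n) = (-2) \<cdot> e_root (Suc n)"
proof -
  have "br x (h_root n) = br (e_root n) (h_root 0)"
    by (simp add: h_root_def leibniz[of x] assms br_linear)
  also have "\<dots> = (-2) \<cdot> e_root (Suc n)"
    using br_swap[of "e_root n" "h_root 0"] h0_e by simp
  finally show ?thesis .
qed

lemma y_h:
  assumes "br y (f_root n) = 0" "br x (f_root n) = h_root n"
  shows "br y (h_root n) = 2 \<cdot> f_root (Suc n)"
proof -
  have "br y (h_root n) = br (br y x) (f_root n)"
    by (simp add: assms(2)[symmetric] leibniz[of y] assms(1) br_linear)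
  also have "\<dots> = - br (h_root 0) (f_root n)"
    using br_swap[of y x] by (simp add: h_root_0 br_linear)
  also have "\<dots> = 2 \<cdot> f_root (Suc n)" unfolding h0_f by simp
  finally show ?thesis .
qed

text \<open>Let \<open>\<delta> = [h\<^sub>0, h\<^sub>n]\<close>. Expanding \<open>h\<^sub>n = [e\<^sub>i, f\<^sub>j]\<close> for all \<open>i + j = n\<close> by the Leibniz rule and summing the
  telescoping results gives \<open>(n + 1) \<delta> = 2 ([e\<^sub>n\<^sub>+\<^sub>1, y] - [x, f\<^sub>n\<^sub>+\<^sub>1])\<close>. Expanding \<open>h\<^sub>0 = [x, y]\<close> instead gives
  \<open>\<delta> = - 2 ([e\<^sub>n\<^sub>+\<^sub>1, y] - [x, f\<^sub>n\<^sub>+\<^sub>1])\<close>. So \<open>(n + 2) \<delta> = 0\<close>.\<close>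

lemma h0_h:
  assumes ef: "\<And>i j. i + j = n \<Longrightarrow> br (e_root i) (f_root j) = h_root n"
    and xe: "br x (e_root n) = 0" and yf: "br y (f_root n) = 0"
  shows "br (h_root 0) (h_root n) = 0"
proof -
  define q where "q i = br (e_root i) (f_root (Suc n - i))" for i
  define \<delta> where "\<delta> = br (h_root 0) (h_root n)"
  have step: "\<delta> = 2 \<cdot> (q (Suc i) - q i)" if "i \<le> n" for i
  proof -
    have "\<delta> = br (h_root 0) (br (e_root i) (f_root (n - i)))"
      using ef[of i "n - i"] that by (simp add: \<delta>_def)
    also have "\<dots> = 2 \<cdot> (q (Suc i) - q i)"
      unfolding leibniz[of "h_root 0"] h0_e h0_f
      using that by (simp add: br_linear q_def Suc_diff_le scale_right_diff_distrib del: e_root.simps f_root.simps)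
    finally show ?thesis .
  qed
  have "2 \<cdot> (q m - q 0) = of_nat m \<cdot> \<delta>" if "m \<le> Suc n" for m
    using that
  proof (induction m)
    case (Suc m)
    have "2 \<cdot> (q (Suc m) - q 0) = 2 \<cdot> (q (Suc m) - q m) + 2 \<cdot> (q m - q 0)"
      by (simp add: scale_right_diff_distrib)
    with Suc step[of m] show ?case by (simp add: scale_left_distrib)
  qed simp
  then have "of_nat (Suc n) \<cdot> \<delta> = 2 \<cdot> (q (Suc n) - q 0)" by simp
  moreover have "\<delta> = - (2 \<cdot> (q (Suc n) - q 0))"
  proof -
    have xf: "br x (f_root n) = h_root n" using ef[of 0 n] by simp
    have "br x (br y (h_root n)) = br (h_root 0) (h_root n) + br y (br x (h_root n))"
      by (simp add: leibniz[of x] h_root_0)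
    then have "\<delta> = br x (2 \<cdot> f_root (Suc n)) - br y ((-2) \<cdot> e_root (Suc n))"
      using x_h[OF xe] y_h[OF yf xf] unfolding \<delta>_def by (metis add_diff_cancel_right')
    also have "\<dots> = 2 \<cdot> br x (f_root (Suc n)) - 2 \<cdot> br (e_root (Suc n)) y"
      using br_swap[of y "e_root (Suc n)"] by (simp only: br_linear) simp
    also have "\<dots> = - (2 \<cdot> (q (Suc n) - q 0))"
      by (simp add: q_def scale_right_diff_distrib)
    finally show ?thesis .
  qed
  ultimately have "of_nat (Suc n) \<cdot> \<delta> + \<delta> = 0" by simp
  then have "of_nat (Suc (Suc n)) \<cdot> \<delta> = 0"
    unfolding of_nat_Suc[of "Suc n"] scale_left_distrib scale_one by (simp only: add.commute)
  moreover have "(of_nat (Suc (Suc n)) :: 'k) \<noteq> 0" by (metis of_nat_eq_0_iff nat.distinct(1))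
  ultimately show ?thesis unfolding \<delta>_def by (simp del: of_nat_Suc)
qed

lemma serre_e: "br x (e_root 1) = 0"
  using serre_x br_swap[of "br x y" x] by (simp add: br_linear)

lemma serre_f: "br y (f_root 1) = 0"
  using serre_y br_swap[of "br x y" y] br_swap[of y x] by (simp add: br_linear)

text \<open>The loop algebra relations follow from the Serre relations by induction on the level \<open>i + j\<close>. Level 1 is
  where the Serre relations enter; beyond it, \<open>ad (h_root 0)\<close> and \<open>ad (h_root 1)\<close> act as raising
  operators that carry the relations upwards.\<close>

lemma root_relations:
  "i + j \<le> n \<Longrightarrow> br (e_root i) (e_root j) = 0 \<and> br (f_root i) (f_root j) = 0 \<and>
     br (e_root i) (f_root j) = h_root (i + j)"
proof (induction n arbitrary: i j rule: less_induct)
  case (less n)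
  show ?case
  proof (cases n)
    case 0
    with less.prems show ?thesis by (simp add: br_self h_root_def)
  next
    case (Suc m)
    note IH = less.IH[of m, unfolded Suc, simplified]
    have xe: "br x (e_root k) = 0" and yf: "br y (f_root k) = 0"
      and xf: "br x (f_root k) = h_root k" if "k \<le> m" for k
      using IH[of 0 k] that by simp_all
    have h0h: "br (h_root 0) (h_root k) = 0" if "k \<le> m" for k
      using h0_h[of k] IH that xe[of k] yf[of k] by auto
    \<comment> \<open>Since \<open>h_root 0\<close> commutes with \<open>[e\<^sub>i, f\<^sub>j]\<close>, a unit can be shifted from one index to the other.\<close>
    have ef: "br (e_root i) (f_root j) = h_root (Suc m)" if "i + j = Suc m" for i j
      using that
    proof (induction j arbitrary: i)
      case (Suc j)
      have "0 = br (h_root 0) (br (e_root i) (f_root j))"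
        using IH[of i j] h0h[of m] Suc.prems by simp
      also have "\<dots> = 2 \<cdot> (br (e_root (Suc i)) (f_root j) - br (e_root i) (f_root (Suc j)))"
        unfolding leibniz[of "h_root 0"] h0_e h0_f
        by (simp add: br_linear scale_right_diff_distrib del: e_root.simps f_root.simps)
      finally have "br (e_root i) (f_root (Suc j)) = br (e_root (Suc i)) (f_root j)"
        by (simp del: e_root.simps f_root.simps)
      also have "\<dots> = h_root (Suc m)"
        using Suc.IH[of "Suc i"] Suc.prems by (simp del: e_root.simps f_root.simps)
      finally show ?case .
    qed (simp add: h_root_def)
    have top: "br (e_root i) (e_root j) = 0 \<and> br (f_root i) (f_root j) = 0" if ij: "i + j = Suc m"
    proof (cases m)
      case 0
      then have "i = 0 \<and> j = 1 \<or> i = 1 \<and> j = 0" using ij by auto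
      then show ?thesis
        using serre_e serre_f br_swap[of "e_root 1" x] br_swap[of "f_root 1" y]
        by (auto simp del: e_root.simps(2) f_root.simps(2))
    next
      case (Suc m')
      have h1e: "br (h_root 1) (e_root k) = 2 \<cdot> e_root (Suc (Suc k))" for k
      proof (induction k)
        case 0
        show ?case using x_h[of 1] serre_e br_swap[of "h_root 1" x]
          by (simp del: e_root.simps(2))
      next
        case (Suc k)
        have "2 \<cdot> br (h_root 1) (e_root (Suc k)) = br (h_root 1) (br (h_root 0) (e_root k))"
          unfolding h0_e by (simp only: br_linear)
        also have "\<dots> = br (h_root 0) (br (h_root 1) (e_root k))"
          using h0h[of 1] \<open>m = Suc m'\<close> br_swap[of "h_root 1" "h_root 0"]
          by (simp add: leibniz[of "h_root 1"] br_linear del: One_nat_def)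
        also have "\<dots> = 2 \<cdot> 2 \<cdot> e_root (Suc (Suc (Suc k)))"
          unfolding Suc.IH br_linear(5) h0_e ..
        finally show ?case by (simp only: scale_left_imp_eq[of 2] scale_cancel_left) simp
      qed
      have h1f: "br (h_root 1) (f_root k) = (-2) \<cdot> f_root (Suc (Suc k))" for k
      proof (induction k)
        case 0
        show ?case using y_h[of 1] serre_f xf[of 1] \<open>m = Suc m'\<close> br_swap[of "h_root 1" y]
          by (simp del: f_root.simps(2))
      next
        case (Suc k)
        have "(-2) \<cdot> br (h_root 1) (f_root (Suc k)) = br (h_root 1) (br (h_root 0) (f_root k))"
          unfolding h0_f by (simp only: br_linear)
        also have "\<dots> = br (h_root 0) (br (h_root 1) (f_root k))"
          using h0h[of 1] \<open>m = Suc m'\<close> br_swap[of "h_root 1" "h_root 0"]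
          by (simp add: leibniz[of "h_root 1"] br_linear del: One_nat_def)
        also have "\<dots> = (-2) \<cdot> (-2) \<cdot> f_root (Suc (Suc (Suc k)))"
          unfolding Suc.IH br_linear(5) h0_f ..
        finally show ?case by (simp only: scale_left_imp_eq[of 2] scale_cancel_left) simp
      qed
      show ?thesis
        using commuting_next_level[of e_root 2 m' i j, OF h0_e h1e]
          commuting_next_level[of f_root "-2" m' i j, OF h0_f h1f] IH ij Suc by simp
    qed
    show ?thesis
    proof (cases "i + j = Suc m")
      case True
      then show ?thesis using top ef by simp
    next
      case False
      with less.prems Suc show ?thesis using IH by simp
    qed
  qed
qed

lemma x_root_relations [simp]:
  "br x (e_root n) = 0" "br x (f_root n) = h_root n" "br x (h_root n) = (-2) \<cdot> e_root (Suc n)"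
  using root_relations[of 0 n n] x_h[of n] by (simp_all del: e_root.simps(2))

lemma y_root_relations [simp]:
  "br y (e_root n) = - h_root n" "br y (f_root n) = 0" "br y (h_root n) = 2 \<cdot> f_root (Suc n)"
  using root_relations[of 0 n n] y_h[of n] br_swap[of y "e_root n"]
  by (simp_all del: f_root.simps(2) add: h_root_def)

text \<open>Total in the bidegree, so that a derivation counting \<open>x\<close> and \<open>y\<close> separates the whole family by its
  indices.\<close>

definition root_vec :: "nat \<Rightarrow> nat \<Rightarrow> 'v" where
  "root_vec p q =
     (if p = Suc q then e_root q else if q = Suc p then f_root p
      else if p = q \<and> p > 0 then h_root (p - 1) else 0)"

definition root_span :: "'v set" where
  "root_span = span (range (\<lambda>(p, q). root_vec p q))"

lemma subspace_root_span: "subspace root_span"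
  by (simp add: root_span_def)

lemma root_vec_in: "root_vec p q \<in> root_span"
  unfolding root_span_def by (rule span_base) auto

lemma roots_in: "e_root n \<in> root_span" "f_root n \<in> root_span" "h_root n \<in> root_span"
  using root_vec_in[of "Suc n" n] root_vec_in[of n "Suc n"] root_vec_in[of "Suc n" "Suc n"]
  by (simp_all add: root_vec_def)

text \<open>The elements whose \<open>ad\<close> maps \<open>root_span\<close> into itself form a subalgebra. It contains \<open>x\<close> and \<open>y\<close> by the
  relations above, hence all root vectors, which are iterated brackets of \<open>x\<close> and \<open>y\<close>.\<close>

lemma root_span_subalgebra:
  assumes "u \<in> root_span" "w \<in> root_span"
  shows "br u w \<in> root_span"
proof -
  define K where "K = {u. \<forall>w\<in>root_span. br u w \<in> root_span}"
  note sub = subspace_0[OF subspace_root_span] subspace_add[OF subspace_root_span]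
    subspace_neg[OF subspace_root_span]
    subspace_scale[OF subspace_root_span] subspace_diff[OF subspace_root_span]
  have K: "subspace K"
    by (auto simp: K_def subspace_def br_linear sub)
  have inK: "u \<in> K" if "\<And>p q. br u (root_vec p q) \<in> root_span" for u
  proof -
    have "br u w \<in> root_span" if "w \<in> root_span" for w
      using that unfolding root_span_def
    proof (induction rule: span_induct)
      case base
      then show ?case by (auto simp: subspace_def br_linear sub[unfolded root_span_def])
    qed (use \<open>\<And>p q. br u (root_vec p q) \<in> root_span\<close> in \<open>auto simp: root_span_def\<close>)
    then show ?thesis by (simp add: K_def)
  qed
  have x: "x \<in> K"
    by (rule inK) (auto simp: root_vec_def br_linear sub roots_in simp del: e_root.simps)
  have y: "y \<in> K"
    by (rule inK) (auto simp: root_vec_def br_linear sub roots_in simp del: f_root.simps)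
  have brK: "br u w \<in> K" if "u \<in> K" "w \<in> K" for u w
  proof -
    have "br (br u w) z = br u (br w z) - br w (br u z)" for z
      by (simp add: leibniz[of u])
    with that show ?thesis by (auto simp: K_def sub)
  qed
  have e: "e_root n \<in> K" for n by (induction n) (auto simp: x y brK intro!: subspace_scale[OF K])
  have f: "f_root n \<in> K" for n
    by (induction n) (auto simp: x y brK simp del: scale_minus_left intro!: subspace_scale[OF K])
  have h: "h_root n \<in> K" for n by (simp add: h_root_def e y brK)
  have "root_span \<subseteq> K"
    unfolding root_span_def
    by (rule span_minimal[OF _ K]) (auto simp: root_vec_def e f h subspace_0[OF K])
  with assms show ?thesis by (auto simp: K_def)
qed

lemma derivation_root_vec:
  assumes "d \<in> derivations scale br" and "d x = a \<cdot> x" "d y = b \<cdot> y"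
  shows "d (root_vec p q) = (of_nat p * a + of_nat q * b) \<cdot> root_vec p q"
proof -
  have d: "d (br u v) = br (d u) v + br u (d v)" for u v
    using assms(1) by (simp add: derivations_def)
  interpret d: Vector_Spaces.linear scale scale d using assms(1) by (simp add: derivations_def)
  have br: "d (br u v) = (a' + b') \<cdot> br u v" if "d u = a' \<cdot> u" "d v = b' \<cdot> v" for u v a' b'
    by (simp add: d that br_linear scale_left_distrib)
  have e: "d (e_root n) = (of_nat (Suc n) * a + of_nat n * b) \<cdot> e_root n" for n
  proof (induction n)
    case (Suc n)
    from br[OF br[OF assms(2,3)] this] show ?case by (simp add: d.scale algebra_simps)
  qed (simp add: assms(2))
  have f: "d (f_root n) = (of_nat n * a + of_nat (Suc n) * b) \<cdot> f_root n" for n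
  proof (induction n)
    case (Suc n)
    from br[OF br[OF assms(2,3)] this] show ?case by (simp add: d.scale d.neg algebra_simps)
  qed (simp add: assms(3))
  have h: "d (h_root n) = (of_nat (Suc n) * a + of_nat (Suc n) * b) \<cdot> h_root n" for n
    using br[OF e[of n] assms(3)] by (simp add: h_root_def algebra_simps)
  show ?thesis
    using e[of q] f[of p] h[of "p - 1"] by (auto simp: root_vec_def d.zero simp del: of_nat_Suc)
qed

end

section \<open>Infinitesimal deformations\<close>

text \<open>
  A pair \<open>(u, u')\<close> stands for \<open>u + \<epsilon> u'\<close> with \<open>\<epsilon>\<^sup>2 = 0\<close>, and \<open>eps_bracket br \<phi>\<close> is the infinitesimal deformation
  \<open>[u, v] + \<epsilon> \<phi>(u, v)\<close> of the bracket. It is a Lie bracket precisely because \<open>\<phi>\<close> is a cocycle.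
\<close>

definition eps_scale :: "('k \<Rightarrow> 'v \<Rightarrow> 'v) \<Rightarrow> 'k \<Rightarrow> 'v \<times> 'v \<Rightarrow> 'v \<times> 'v" where
  "eps_scale s c = map_prod (s c) (s c)"

definition eps_bracket ::
  "('v::ab_group_add \<Rightarrow> 'v \<Rightarrow> 'v) \<Rightarrow> ('v \<Rightarrow> 'v \<Rightarrow> 'v) \<Rightarrow> 'v \<times> 'v \<Rightarrow> 'v \<times> 'v \<Rightarrow> 'v \<times> 'v" where
  "eps_bracket br \<phi> u v = (br (fst u) (fst v), br (fst u) (snd v) + br (snd u) (fst v) + \<phi> (fst u) (fst v))"

locale lie_cocycle = char0_lie_algebra scale br
  for scale :: "'k::field_char_0 \<Rightarrow> 'v::ab_group_add \<Rightarrow> 'v" (infixr "\<cdot>" 75)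
    and br :: "'v \<Rightarrow> 'v \<Rightarrow> 'v" +
  fixes \<phi> :: "'v \<Rightarrow> 'v \<Rightarrow> 'v"
  assumes cocycle: "\<phi> \<in> CE_Z2 scale UNIV br"
begin

lemma cocycle_bilinear:
  "\<phi> (u + v) w = \<phi> u w + \<phi> v w" "\<phi> u (v + w) = \<phi> u v + \<phi> u w"
  "\<phi> (c \<cdot> u) w = c \<cdot> \<phi> u w" "\<phi> u (c \<cdot> w) = c \<cdot> \<phi> u w" "\<phi> u u = 0"
  using cocycle by (auto simp: CE_Z2_def CE_C2_def)

lemma cocycle_swap: "\<phi> v u = - \<phi> u v"
  using cochain_swap[of \<phi> u v] cocycle by (simp add: CE_Z2_def)

lemma cocycle_identity:
  "br u (\<phi> v w) - br v (\<phi> u w) + br w (\<phi> u v)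
     - \<phi> (br u v) w + \<phi> (br u w) v - \<phi> (br v w) u = 0"
  using cocycle by (auto simp: CE_Z2_def CE_d2_def)

lemma vector_space_eps: "vector_space (eps_scale scale)"
  by unfold_locales (auto simp: eps_scale_def scale_right_distrib scale_left_distrib)

lemma char0_lie_algebra_eps: "char0_lie_algebra (eps_scale scale) (eps_bracket br \<phi>)"
proof -
  interpret E: vector_space "eps_scale scale" by (rule vector_space_eps)
  show ?thesis
  proof
    fix a b c :: "'v \<times> 'v"
    obtain u u' v v' w w' where abc: "a = (u, u')" "b = (v, v')" "c = (w, w')"
      by (metis surj_pair)
    have "br u (br v w') + br u (br v' w) + br u (\<phi> v w) + br u' (br v w) + \<phi> u (br v w)
        + (br v (br w u') + br v (br w' u) + br v (\<phi> w u) + br v' (br w u) + \<phi> v (br w u))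
        + (br w (br u v') + br w (br u' v) + br w (\<phi> u v) + br w' (br u v) + \<phi> w (br u v))
      = (br u (br v w') + br v (br w' u) + br w' (br u v))
        + (br u (br v' w) + br v' (br w u) + br w (br u v'))
        + (br u' (br v w) + br v (br w u') + br w (br u' v))
        + (br u (\<phi> v w) + br v (\<phi> w u) + br w (\<phi> u v) + \<phi> u (br v w) + \<phi> v (br w u) + \<phi> w (br u v))"
      by (simp add: algebra_simps)
    also have "\<dots> = br u (\<phi> v w) + br v (\<phi> w u) + br w (\<phi> u v) + \<phi> u (br v w) + \<phi> v (br w u) + \<phi> w (br u v)"
      using jacobi by simp
    also have "\<dots> = 0"
      using cocycle_identity[of u v w] cocycle_bilinear(4)[of v "-1" "br u w"] cocycle_swap[of "br u w" v]
      by (simp add: cocycle_swap[of w u] cocycle_swap[of u "br v w"] cocycle_swap[of v "br w u"]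
        cocycle_swap[of w "br u v"] br_swap[of w u] br_linear algebra_simps)
    finally show "eps_bracket br \<phi> a (eps_bracket br \<phi> b c) + eps_bracket br \<phi> b (eps_bracket br \<phi> c a)
        + eps_bracket br \<phi> c (eps_bracket br \<phi> a b) = 0"
      using jacobi[of u v w]
      by (simp add: abc eps_bracket_def zero_prod_def br_linear add.assoc)
  next
    fix a
    show "eps_bracket br \<phi> a a = 0"
      using br_swap[of "fst a" "snd a"]
      by (simp add: eps_bracket_def zero_prod_def br_self cocycle_bilinear)
  qed (auto simp: eps_bracket_def eps_scale_def br_linear cocycle_bilinear scale_right_distrib algebra_simps)
qed

lemma derivation_eps:
  assumes d: "d \<in> derivations scale br" and inv: "\<And>u v. d (\<phi> u v) = \<phi> (d u) v + \<phi> u (d v)"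
  shows "map_prod d d \<in> derivations (eps_scale scale) (eps_bracket br \<phi>)"
proof -
  interpret d: Vector_Spaces.linear scale scale d using d by (simp add: derivations_def)
  interpret E: vector_space "eps_scale scale" by (rule vector_space_eps)
  have "Vector_Spaces.linear (eps_scale scale) (eps_scale scale) (map_prod d d)"
    by unfold_locales (auto simp: eps_scale_def d.add d.scale)
  moreover have "map_prod d d (eps_bracket br \<phi> u v) =
      eps_bracket br \<phi> (map_prod d d u) v + eps_bracket br \<phi> u (map_prod d d v)" for u v
    using d by (simp add: eps_bracket_def derivations_def d.add inv)
  ultimately show ?thesis by (simp add: derivations_def)
qed

end

section \<open>Rigidity of bigraded algebras with two generators\<close>

text \<open>
  \<open>d1\<close> and \<open>d2\<close> count the occurrences of \<open>x\<close> and \<open>y\<close> in a bracket of generators. The last two assumptions say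
  that bidegrees (3, 1) and (1, 3) are empty; they give the Serre relations here, and again in every
  deformation that respects the bidegree.
\<close>

locale bigraded_pair = char0_lie_algebra scale br
  for scale :: "complex \<Rightarrow> 'v::ab_group_add \<Rightarrow> 'v" (infixr "\<cdot>" 75)
    and br :: "'v \<Rightarrow> 'v \<Rightarrow> 'v" +
  fixes x y :: 'v and d1 d2 :: "'v \<Rightarrow> 'v"
  assumes d1: "d1 \<in> derivations scale br" and d2: "d2 \<in> derivations scale br"
    and d1_gens: "d1 x = x" "d1 y = 0" and d2_gens: "d2 x = 0" "d2 y = y"
    and generated: "\<And>S. \<lbrakk>subspace S; x \<in> S; y \<in> S; \<And>u v. u \<in> S \<Longrightarrow> v \<in> S \<Longrightarrow> br u v \<in> S\<rbrakk> \<Longrightarrow> S = UNIV"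
    and no_31: "\<And>u. d1 u = 3 \<cdot> u \<Longrightarrow> d2 u = 1 \<cdot> u \<Longrightarrow> u = 0"
    and no_13: "\<And>u. d1 u = 1 \<cdot> u \<Longrightarrow> d2 u = 3 \<cdot> u \<Longrightarrow> u = 0"
begin

lemma serre_degree:
  assumes "d \<in> derivations scale br" "d u = a \<cdot> u" "d v = b \<cdot> v"
  shows "d (br u (br u (br u v))) = (3 * a + b) \<cdot> br u (br u (br u v))"
  using derivation_br_eigenvectors[OF assms(1,2) derivation_br_eigenvectors[OF assms(1,2)
      derivation_br_eigenvectors[OF assms]]]
  by (simp add: algebra_simps)

sublocale serre_pair scale br x y
proof
  show "br x (br x (br x y)) = 0"
    using serre_degree[OF d1, of x 1 y 0] serre_degree[OF d2, of x 0 y 1] d1_gens d2_gens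
    by (intro no_31) simp_all
  show "br y (br y (br y x)) = 0"
    using serre_degree[OF d1, of y 0 x 1] serre_degree[OF d2, of y 1 x 0] d1_gens d2_gens
    by (intro no_13) simp_all
qed

lemma root_span_UNIV: "root_span = UNIV"
proof (rule generated)
  show "x \<in> root_span" using roots_in(1)[of 0] by simp
  show "y \<in> root_span" using roots_in(2)[of 0] by simp
qed (auto intro: subspace_root_span root_span_subalgebra)

text \<open>The eigenvalue \<open>p + \<i> q\<close> of this single derivation determines the bidegree \<open>(p, q)\<close>.\<close>

definition degree :: "'v \<Rightarrow> 'v" where
  "degree u = d1 u + \<i> \<cdot> d2 u"

lemma linear_degree: "Vector_Spaces.linear scale scale degree"
proof -
  interpret d1: Vector_Spaces.linear scale scale d1 using d1 by (simp add: derivations_def)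
  interpret d2: Vector_Spaces.linear scale scale d2 using d2 by (simp add: derivations_def)
  show ?thesis
    by unfold_locales
      (simp_all add: degree_def d1.add d2.add d1.scale d2.scale scale_right_distrib mult.commute)
qed

lemma d_root_vec:
  "d1 (root_vec p q) = of_nat p \<cdot> root_vec p q" "d2 (root_vec p q) = of_nat q \<cdot> root_vec p q"
  using derivation_root_vec[OF d1, of 1 0] derivation_root_vec[OF d2, of 0 1] d1_gens d2_gens
  by simp_all

lemma degree_root_vec: "degree (root_vec p q) = Complex (of_nat p) (of_nat q) \<cdot> root_vec p q"
proof -
  have "Complex (of_nat p) (of_nat q) = of_nat p + \<i> * of_nat q" by (simp add: complex_eq_iff)
  then show ?thesis by (simp add: degree_def d_root_vec scale_left_distrib)
qed

lemma root_vec_00: "root_vec 0 0 = 0"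
  by (simp add: root_vec_def)

lemma degree_eigenvector:
  assumes "degree u = m \<cdot> u" "u \<noteq> 0"
  obtains p q c where "m = Complex (of_nat p) (of_nat q)" "(p, q) \<noteq> (0, 0)" "u = c \<cdot> root_vec p q"
proof -
  have "\<exists>i c. m = (\<lambda>(p, q). Complex (of_nat p) (of_nat q)) i \<and> u = c \<cdot> (\<lambda>(p, q). root_vec p q) i"
  proof (rule eigenvector_in_span[OF linear_degree])
    show "u \<in> span (range (\<lambda>(p, q). root_vec p q))"
      using root_span_UNIV unfolding root_span_def by simp
  qed (use assms in \<open>auto simp: degree_root_vec inj_def\<close>)
  then obtain p q c where "m = Complex (of_nat p) (of_nat q)" "u = c \<cdot> root_vec p q" by auto
  moreover from this assms(2) have "(p, q) \<noteq> (0, 0)" by (metis root_vec_00 Pair_inject scale_zero_right)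
  ultimately show ?thesis using that by blast
qed

lemma degree_eigenspace:
  assumes "degree u = Complex (of_nat p) (of_nat q) \<cdot> u"
  obtains c where "u = c \<cdot> root_vec p q"
proof (cases "u = 0")
  case True
  with that[of 0] show ?thesis by simp
next
  case False
  from degree_eigenvector[OF assms this] that show ?thesis by auto
qed

text \<open>The heart of the proof. The deformation of the bracket by \<open>\<phi>\<close> carries the same bigrading, so it has no
  elements of bidegree (3, 1) or (1, 3) either, and \<open>(x, 0)\<close>, \<open>(y, 0)\<close> satisfy the Serre relations in it. The
  subalgebra generated by them is therefore spanned by one root vector in each bidegree. It projects onto
  the undeformed algebra because \<open>x\<close> and \<open>y\<close> generate the latter. The projection is injective: root vectors
  of distinct bidegrees remain independent, and a root vector that projects to zero lies in an empty
  bidegree. So the subalgebra is the graph of a linear map \<open>\<gamma>\<close>, and closure of the graph under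
  the deformed bracket says that \<open>\<phi>\<close> is the coboundary of \<open>-\<gamma>\<close>.\<close>

theorem invariant_cocycle_trivial:
  assumes "\<phi> \<in> CE_Z2 scale UNIV br"
    and inv1: "\<And>u v. d1 (\<phi> u v) = \<phi> (d1 u) v + \<phi> u (d1 v)"
    and inv2: "\<And>u v. d2 (\<phi> u v) = \<phi> (d2 u) v + \<phi> u (d2 v)"
  obtains g where "Vector_Spaces.linear scale scale g"
    "\<And>u. g (d1 u) = d1 (g u)" "\<And>u. g (d2 u) = d2 (g u)"
    "\<And>u v. \<phi> u v = br u (g v) - br v (g u) - g (br u v)"
proof -
  interpret lie_cocycle scale br \<phi> by unfold_locales fact
  interpret lin1: Vector_Spaces.linear scale scale d1 using d1 by (simp add: derivations_def)
  interpret lin2: Vector_Spaces.linear scale scale d2 using d2 by (simp add: derivations_def)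
  interpret degree: Vector_Spaces.linear scale scale degree by (rule linear_degree)
  let ?br = "eps_bracket br \<phi>"
  interpret E: char0_lie_algebra "eps_scale scale" ?br by (rule char0_lie_algebra_eps)
  define D1 D2 where "D1 = map_prod d1 d1" and "D2 = map_prod d2 d2"
  have D: "D1 \<in> derivations (eps_scale scale) ?br" "D2 \<in> derivations (eps_scale scale) ?br"
    unfolding D1_def D2_def using derivation_eps d1 d2 inv1 inv2 by blast+
  have gens: "D1 (x, 0) = eps_scale scale 1 (x, 0)" "D1 (y, 0) = eps_scale scale 0 (y, 0)"
    "D2 (x, 0) = eps_scale scale 0 (x, 0)" "D2 (y, 0) = eps_scale scale 1 (y, 0)"
    by (simp_all add: D1_def D2_def eps_scale_def d1_gens d2_gens lin1.zero lin2.zero zero_prod_def)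
  have eps_no_31: "w = 0" if "D1 w = eps_scale scale 3 w" "D2 w = eps_scale scale 1 w" for w
    using that no_31[of "fst w"] no_31[of "snd w"]
    by (cases w) (auto simp: D1_def D2_def eps_scale_def zero_prod_def)
  have eps_no_13: "w = 0" if "D1 w = eps_scale scale 1 w" "D2 w = eps_scale scale 3 w" for w
    using that no_13[of "fst w"] no_13[of "snd w"]
    by (cases w) (auto simp: D1_def D2_def eps_scale_def zero_prod_def)
  have serre_degree_E: "d (?br u (?br u (?br u v))) = eps_scale scale (3 * a + b) (?br u (?br u (?br u v)))"
    if "d \<in> derivations (eps_scale scale) ?br" "d u = eps_scale scale a u" "d v = eps_scale scale b v"
    for d u v a b
    using E.derivation_br_eigenvectors[OF that(1,2) E.derivation_br_eigenvectors[OF that(1,2)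
      E.derivation_br_eigenvectors[OF that]]]
    by (simp add: algebra_simps)
  interpret E: serre_pair "eps_scale scale" ?br "(x, 0)" "(y, 0)"
  proof
    show "?br (x, 0) (?br (x, 0) (?br (x, 0) (y, 0))) = 0"
      using serre_degree_E[OF D(1) gens(1,2)] serre_degree_E[OF D(2) gens(3,4)]
      by (intro eps_no_31) simp_all
    show "?br (y, 0) (?br (y, 0) (?br (y, 0) (x, 0))) = 0"
      using serre_degree_E[OF D(1) gens(2,1)] serre_degree_E[OF D(2) gens(4,3)]
      by (intro eps_no_13) simp_all
  qed
  define V where "V = (\<lambda>(p, q). E.root_vec p q)"
  define l where "l = (\<lambda>(p, q). Complex (of_nat p) (of_nat q))"
  have inj_l: "inj l" by (auto simp: l_def inj_def)
  have D_V: "D1 (V i) = eps_scale scale (of_nat (fst i)) (V i)"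
    "D2 (V i) = eps_scale scale (of_nat (snd i)) (V i)" for i
    using E.derivation_root_vec[OF D(1) gens(1,2), of "fst i" "snd i"]
      E.derivation_root_vec[OF D(2) gens(3,4), of "fst i" "snd i"]
    by (simp_all add: V_def case_prod_beta)
  have deg: "degree (fst (V i)) = l i \<cdot> fst (V i)" "degree (snd (V i)) = l i \<cdot> snd (V i)" for i
  proof -
    have "l i = of_nat (fst i) + \<i> * of_nat (snd i)" by (simp add: l_def complex_eq_iff case_prod_beta)
    then show "degree (fst (V i)) = l i \<cdot> fst (V i)" "degree (snd (V i)) = l i \<cdot> snd (V i)"
      using arg_cong[OF D_V(1)[of i], of fst] arg_cong[OF D_V(2)[of i], of fst]
        arg_cong[OF D_V(1)[of i], of snd] arg_cong[OF D_V(2)[of i], of snd]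
      by (simp_all add: degree_def D1_def D2_def eps_scale_def scale_left_distrib)
  qed
  have fst_e: "fst (E.e_root n) = e_root n" and fst_f: "fst (E.f_root n) = f_root n" for n
    by (induction n) (simp_all add: eps_scale_def eps_bracket_def)
  have fst_V: "fst (V i) = root_vec (fst i) (snd i)" for i
    by (auto simp: V_def case_prod_beta root_vec_def E.root_vec_def fst_e fst_f
      h_root_def E.h_root_def eps_bracket_def)
  \<comment> \<open>If \<open>root_vec p q\<close> vanishes in the undeformed algebra, then so does everything of bidegree \<open>(p, q)\<close>.\<close>
  have V_0: "V i = 0" if "fst (V i) = 0" for i
  proof -
    have "snd (V i) = 0"
      using degree_eigenspace[of "snd (V i)" "fst i" "snd i"] deg(2)[of i] fst_V[of i] that
      by (auto simp: l_def case_prod_beta)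
    with that show ?thesis by (simp add: prod_eq_iff)
  qed
  note subS = E.subspace_root_span
  have graph0: "u = 0" if u: "(0, u) \<in> E.root_span" for u
  proof -
    obtain F c where F: "finite F" and sum: "(0, u) = (\<Sum>i\<in>F. eps_scale scale (c i) (V i))"
      using E.span_range_sum u unfolding E.root_span_def V_def by metis
    have "(\<Sum>i\<in>F. c i \<cdot> fst (V i)) = 0"
      using arg_cong[OF sum, of fst] by (simp add: fst_sum eps_scale_def)
    then have cV: "c i \<cdot> fst (V i) = 0" if "i \<in> F" for i
      using eigenvectors_sum_zero[OF linear_degree F inj_on_subset[OF inj_l], of "\<lambda>i. c i \<cdot> fst (V i)" i]
        that deg(1)
      by (simp add: degree.scale mult.commute)
    have "eps_scale scale (c i) (V i) = 0" if "i \<in> F" for i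
      using cV[OF that] V_0[of i] unfolding scale_eq_0_iff
      by (auto simp: eps_scale_def zero_prod_def prod_eq_iff)
    then have "(\<Sum>i\<in>F. eps_scale scale (c i) (V i)) = 0" by (intro sum.neutral ballI)
    with sum have "(0 :: 'v, u) = 0" by simp
    then show ?thesis by (simp add: zero_prod_def)
  qed
  have total: "\<exists>u'. (u, u') \<in> E.root_span" for u
  proof -
    have "{u. \<exists>u'. (u, u') \<in> E.root_span} = UNIV"
    proof (rule generated)
      show "subspace {u. \<exists>u'. (u, u') \<in> E.root_span}"
        unfolding subspace_def
        using E.subspace_0[OF subS] E.subspace_add[OF subS] E.subspace_scale[OF subS]
        by (auto simp: zero_prod_def eps_scale_def) (metis add_Pair, metis map_prod_simp)
      show "x \<in> {u. \<exists>u'. (u, u') \<in> E.root_span}" "y \<in> {u. \<exists>u'. (u, u') \<in> E.root_span}"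
        using E.roots_in(1)[of 0] E.roots_in(2)[of 0] by auto
      fix u v assume "u \<in> {u. \<exists>u'. (u, u') \<in> E.root_span}" "v \<in> {u. \<exists>u'. (u, u') \<in> E.root_span}"
      then obtain u' v' where "(u, u') \<in> E.root_span" "(v, v') \<in> E.root_span" by auto
      from E.root_span_subalgebra[OF this]
      show "br u v \<in> {u. \<exists>u'. (u, u') \<in> E.root_span}" by (auto simp: eps_bracket_def)
    qed
    then show ?thesis by blast
  qed
  then obtain \<gamma> where \<gamma>: "\<And>u. (u, \<gamma> u) \<in> E.root_span" by metis
  have unique: "\<gamma> u = u'" if "(u, u') \<in> E.root_span" for u u'
    using graph0[of "\<gamma> u - u'"] E.subspace_diff[OF subS \<gamma>[of u] that] by simp
  have lin: "Vector_Spaces.linear scale scale \<gamma>"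
  proof
    fix u v c
    show "\<gamma> (u + v) = \<gamma> u + \<gamma> v"
      using E.subspace_add[OF subS \<gamma>[of u] \<gamma>[of v]] by (intro unique) simp
    show "\<gamma> (c \<cdot> u) = c \<cdot> \<gamma> u"
      using E.subspace_scale[OF subS \<gamma>[of u], of c] by (intro unique) (simp add: eps_scale_def)
  qed
  have br\<gamma>: "\<gamma> (br u v) = br u (\<gamma> v) + br (\<gamma> u) v + \<phi> u v" for u v
    using E.root_span_subalgebra[OF \<gamma>[of u] \<gamma>[of v]] by (intro unique) (simp add: eps_bracket_def)
  have comm: "\<gamma> (d u) = d (\<gamma> u)"
    if d: "map_prod d d \<in> derivations (eps_scale scale) ?br"
      and V: "\<And>i. \<exists>c. map_prod d d (V i) = eps_scale scale c (V i)" for d u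
  proof -
    interpret d: Vector_Spaces.linear "eps_scale scale" "eps_scale scale" "map_prod d d"
      using d by (simp add: derivations_def)
    have "map_prod d d w \<in> E.root_span" if "w \<in> E.root_span" for w
      using that unfolding E.root_span_def
    proof (induction rule: E.span_induct)
      case base
      show ?case by (auto simp: E.subspace_def d.zero d.add d.scale E.span_zero E.span_add E.span_scale)
    next
      case (step w)
      then obtain i where "w = V i" by (auto simp: V_def)
      with V[of i] show ?case
        using E.subspace_scale[OF subS E.root_vec_in[of "fst i" "snd i"]]
        by (auto simp: V_def case_prod_beta E.root_span_def)
    qed
    from this[OF \<gamma>[of u]] show ?thesis by (intro unique) simp
  qed
  interpret \<gamma>: Vector_Spaces.linear scale scale \<gamma> by (rule lin)
  have "Vector_Spaces.linear scale scale (\<lambda>u. - \<gamma> u)"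
    by unfold_locales (simp_all add: \<gamma>.add \<gamma>.scale)
  moreover have "\<gamma> (d1 u) = d1 (\<gamma> u)" "\<gamma> (d2 u) = d2 (\<gamma> u)" for u
    using comm[of d1] comm[of d2] D D_V unfolding D1_def D2_def by blast+
  moreover have "\<phi> u v = br u (- \<gamma> v) - br v (- \<gamma> u) - - \<gamma> (br u v)" for u v
    unfolding br\<gamma> using br_swap[of v "\<gamma> u"] by (simp add: br_linear)
  ultimately show ?thesis
    by (intro that[of "\<lambda>u. - \<gamma> u"]) (simp_all add: lin1.neg lin2.neg)
qed

end

section \<open>The semidirect product with the torus\<close>

definition nil_part :: "'v \<Rightarrow> 'v \<times> ('v \<Rightarrow> 'v::zero)" where "nil_part n = (n, 0)"
definition tor_part :: "('v \<Rightarrow> 'v) \<Rightarrow> 'v::zero \<times> ('v \<Rightarrow> 'v)" where "tor_part t = (0, t)"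

lemma part_simps [simp]:
  "fst (nil_part n) = n" "snd (nil_part n) = 0" "fst (tor_part t) = 0" "snd (tor_part t) = t"
  by (simp_all add: nil_part_def tor_part_def)

lemma part_decomposition: "v = nil_part (fst v) + tor_part (snd v)"
  for v :: "'v::ab_group_add \<times> ('v \<Rightarrow> 'v)"
  by (simp add: prod_eq_iff)

locale graded_semidirect = bigraded_pair scale br x y d1 d2
  for scale :: "complex \<Rightarrow> 'v::ab_group_add \<Rightarrow> 'v" (infixr "\<cdot>" 75)
    and br :: "'v \<Rightarrow> 'v \<Rightarrow> 'v" and x y :: 'v and d1 d2 :: "'v \<Rightarrow> 'v" +
  fixes T :: "('v \<Rightarrow> 'v) set"
  assumes torus: "torus scale br T" and d_in_T: "d1 \<in> T" "d2 \<in> T"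
    and T_combination: "\<And>t. t \<in> T \<Longrightarrow> \<exists>a b. \<forall>u. t u = a \<cdot> d1 u + b \<cdot> d2 u"
begin

lemma T_subspace: "module.subspace (fun_scale scale) T"
  using torus by (simp add: torus_def)

lemma T_closed:
  "0 \<in> T" "t \<in> T \<Longrightarrow> t' \<in> T \<Longrightarrow> t + t' \<in> T" "t \<in> T \<Longrightarrow> fun_scale scale c t \<in> T"
proof -
  interpret F: vector_space "fun_scale scale"
    by (rule vector_space_fun_scale) (rule vector_space_axioms)
  show "0 \<in> T" "t \<in> T \<Longrightarrow> t' \<in> T \<Longrightarrow> t + t' \<in> T" "t \<in> T \<Longrightarrow> fun_scale scale c t \<in> T"
    using T_subspace by (simp_all add: F.subspace_def)
qed

lemma T_derivation: "t \<in> T \<Longrightarrow> t \<in> derivations scale br"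
  using torus by (auto simp: torus_def)

lemma derivation_linear:
  assumes "t \<in> derivations scale br"
  shows "t (u + v) = t u + t v" "t (c \<cdot> u) = c \<cdot> t u" "t 0 = 0" "t (u - v) = t u - t v" "t (- u) = - t u"
    "t (br u v) = br (t u) v + br u (t v)"
proof -
  interpret t: Vector_Spaces.linear scale scale t using assms by (simp add: derivations_def)
  show "t (u + v) = t u + t v" "t (c \<cdot> u) = c \<cdot> t u" "t 0 = 0" "t (u - v) = t u - t v" "t (- u) = - t u"
    by (fact t.add t.scale t.zero t.diff t.neg)+
  show "t (br u v) = br (t u) v + br u (t v)" using assms by (simp add: derivations_def)
qed

lemmas T_linear = derivation_linear[OF T_derivation]

lemma T_root_vec:
  assumes "t \<in> T"
  obtains a b where "\<And>p q. t (root_vec p q) = (of_nat p * a + of_nat q * b) \<cdot> root_vec p q"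
proof -
  obtain a b where "\<And>u. t u = a \<cdot> d1 u + b \<cdot> d2 u" using T_combination[OF assms] by blast
  then show ?thesis
    by (intro that[of a b]) (simp add: d_root_vec scale_left_distrib mult.commute)
qed

lemma degree_in_T: "degree \<in> T"
proof -
  have "degree = d1 + fun_scale scale \<i> d2" by (simp add: fun_eq_iff degree_def fun_scale_def)
  then show ?thesis using T_closed d_in_T by simp
qed

lemma root_induct:
  assumes "subspace K" "\<And>p q. root_vec p q \<in> K"
  shows "u \<in> K"
proof -
  have "root_span \<subseteq> K"
    unfolding root_span_def by (rule span_minimal[OF _ assms(1)]) (use assms(2) in auto)
  then show ?thesis using root_span_UNIV by auto
qed

lemma derivation_eq_0:
  assumes "d \<in> derivations scale br" "d x = 0" "d y = 0"
  shows "d u = 0"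
proof -
  have "{u. d u = 0} = UNIV"
    by (rule generated) (auto simp: assms(2,3) subspace_def derivation_linear[OF assms(1)] br_linear)
  then show ?thesis by auto
qed

abbreviation "rs \<equiv> semidirect_scale scale"
abbreviation "rL \<equiv> semidirect_carrier T"
abbreviation "rbr \<equiv> semidirect_bracket br"

lemma lie_R: "lie_algebra rs rL rbr"
  using lie_algebra_semidirect[OF lie_algebra_axioms torus] .

lemma parts_in_rL: "nil_part n \<in> rL" "tor_part t \<in> rL \<longleftrightarrow> t \<in> T" "v \<in> rL \<longleftrightarrow> snd v \<in> T"
  using T_closed(1) by (auto simp: semidirect_carrier_def nil_part_def tor_part_def mem_Times_iff)

lemma rbr_parts:
  "rbr (nil_part n) (nil_part m) = nil_part (br n m)"
  "t \<in> T \<Longrightarrow> rbr (tor_part t) (nil_part n) = nil_part (t n)"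
  "t \<in> T \<Longrightarrow> rbr (nil_part n) (tor_part t) = nil_part (- t n)"
  "t \<in> T \<Longrightarrow> t' \<in> T \<Longrightarrow> rbr (tor_part t) (tor_part t') = 0"
  by (simp_all add: semidirect_bracket_def nil_part_def tor_part_def br_linear T_linear zero_prod_def)

lemma parts_linear:
  "nil_part (a + b) = nil_part a + nil_part b" "nil_part (c \<cdot> a) = rs c (nil_part a)" "nil_part 0 = 0"
  "tor_part (t + t') = tor_part t + tor_part t'" "tor_part (fun_scale scale c t) = rs c (tor_part t)"
  "tor_part 0 = 0"
  by (simp_all add: nil_part_def tor_part_def semidirect_scale_def fun_scale_def zero_prod_def fun_eq_iff)

lemma rs_parts: "fst (rs c v) = c \<cdot> fst v" "snd (rs c v) = fun_scale scale c (snd v)"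
  by (simp_all add: semidirect_scale_def)

lemma fun_scale_zero: "fun_scale scale c 0 = 0" "fun_scale scale 0 t = 0"
  by (simp_all add: fun_scale_def fun_eq_iff)

lemma nil_part_eigenvector:
  "rbr (tor_part degree) (nil_part (root_vec p q)) = rs (Complex (of_nat p) (of_nat q)) (nil_part (root_vec p q))"
  by (simp add: rbr_parts degree_in_T degree_root_vec parts_linear)

lemma tor_part_eigenvector: "t \<in> T \<Longrightarrow> rbr (tor_part degree) (tor_part t) = rs 0 (tor_part t)"
  by (simp add: rbr_parts degree_in_T) (simp add: prod_eq_iff rs_parts fun_scale_zero)

lemma homogeneous_cocycle:
  assumes f: "f \<in> CE_Z2 rs rL rbr"
  obtains g where "g \<in> CE_C1 rs rL"
    "\<And>v w l m. \<lbrakk>v \<in> rL; w \<in> rL; rbr (tor_part degree) v = rs l v; rbr (tor_part degree) w = rs m w\<rbrakk> \<Longrightarrow>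
      rbr (tor_part degree) ((f - lie_algebra.coboundary rL rbr g) v w) =
        rs (l + m) ((f - lie_algebra.coboundary rL rbr g) v w)"
proof -
  interpret R: lie_algebra rs rL rbr by (rule lie_R)
  let ?E = "{v \<in> rL. \<exists>l. rbr (tor_part degree) v = rs l v}"
  have "rL \<subseteq> R.span ?E"
  proof
    fix v assume v: "v \<in> rL"
    have "n \<in> {n. nil_part n \<in> R.span ?E}" for n
    proof (rule root_induct)
      show "subspace {n. nil_part n \<in> R.span ?E}"
        unfolding subspace_def by (auto simp: parts_linear intro: R.span_zero R.span_add R.span_scale)
      show "root_vec p q \<in> {n. nil_part n \<in> R.span ?E}" for p q
        using nil_part_eigenvector[of p q] by (auto intro!: R.span_base simp: parts_in_rL T_closed)
    qed
    moreover have "tor_part (snd v) \<in> R.span ?E"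
      using tor_part_eigenvector[of "snd v"] v by (auto intro!: R.span_base simp: parts_in_rL)
    ultimately show "v \<in> R.span ?E" by (subst part_decomposition) (auto intro: R.span_add)
  qed
  from R.homogeneous_representative[OF _ this f] degree_in_T that show ?thesis
    by (auto simp: parts_in_rL)
qed

text \<open>The zero eigenspace of \<open>ad degree\<close> is the torus and the others lie in the nilpotent part, because
  bidegree \<open>(0, 0)\<close> is empty there.\<close>

lemma degree_eigenvector_R:
  assumes "v \<in> rL" "rbr (tor_part degree) v = rs l v"
  shows "degree (fst v) = l \<cdot> fst v" "l \<noteq> 0 \<Longrightarrow> snd v = 0" "l = 0 \<Longrightarrow> fst v = 0"
proof -
  have t: "snd v \<in> T" using assms(1) by (simp add: parts_in_rL)
  then have "rbr (tor_part degree) v = nil_part (degree (fst v))"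
    by (simp add: semidirect_bracket_def prod_eq_iff br_linear T_linear)
  then have "degree (fst v) = l \<cdot> fst v" "fun_scale scale l (snd v) = 0"
    using assms(2) by (simp_all add: prod_eq_iff rs_parts)
  then show deg: "degree (fst v) = l \<cdot> fst v" and "l \<noteq> 0 \<Longrightarrow> snd v = 0"
    by (auto simp: fun_scale_def fun_eq_iff)
  show "fst v = 0" if "l = 0"
  proof (rule ccontr)
    assume "fst v \<noteq> 0"
    from degree_eigenvector[OF deg this] that show False by (auto simp: complex_eq_iff)
  qed
qed

text \<open>For a homogeneous cocycle \<open>F\<close> and \<open>t\<close> in the torus, the map \<open>C t = F(t, _)\<close> preserves every bidegree of the
  nilpotent part; these have dimension at most one, so \<open>C t\<close> commutes with the torus. The cocycle identity at \<open>(t, t', n)\<close> then shows that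
  \<open>F(t, t') \<in> T\<close> annihilates \<open>n\<close>, hence is zero. The identity at \<open>(t, n, m)\<close> shows that \<open>C t\<close> is a derivation,
  as \<open>F\<close> is equivariant on the nilpotent part. A derivation acting by scalars on \<open>x\<close> and \<open>y\<close> is a combination
  of \<open>d1\<close> and \<open>d2\<close>, so \<open>C t\<close> lies in the torus and \<open>F(t, n) = [C t, n]\<close>. Thus the cochain \<open>t \<mapsto> C t\<close>,
  extended by zero to the nilpotent part, has a coboundary that agrees with \<open>F\<close> whenever one argument is
  in the torus.\<close>

lemma normalize_torus_part:
  assumes F_Z2: "F \<in> CE_Z2 rs rL rbr"
    and hom: "\<And>v w l m. \<lbrakk>v \<in> rL; w \<in> rL; rbr (tor_part degree) v = rs l v; rbr (tor_part degree) w = rs m w\<rbrakk> \<Longrightarrow>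
      rbr (tor_part degree) (F v w) = rs (l + m) (F v w)"
  obtains h where "h \<in> CE_C1 rs rL"
    "\<And>t v. \<lbrakk>t \<in> T; v \<in> rL\<rbrakk> \<Longrightarrow> (F - lie_algebra.coboundary rL rbr h) (tor_part t) v = 0"
    "\<And>n m. snd ((F - lie_algebra.coboundary rL rbr h) (nil_part n) (nil_part m)) = 0"
proof -
  interpret R: lie_algebra rs rL rbr by (rule lie_R)
  have F_C2: "F \<in> CE_C2 rs rL" using F_Z2 by (simp add: CE_Z2_def)
  have F_L: "F v w \<in> rL" if "v \<in> rL" "w \<in> rL" for v w using F_C2 that by (auto simp: CE_C2_def)
  have F_add: "F (u + v) w = F u w + F v w" "F w (u + v) = F w u + F w v"
    if "u \<in> rL" "v \<in> rL" "w \<in> rL" for u v w using F_C2 that by (auto simp: CE_C2_def)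
  have F_scale: "F (rs c v) w = rs c (F v w)" "F w (rs c v) = rs c (F w v)"
    if "v \<in> rL" "w \<in> rL" for v w c using F_C2 that by (auto simp: CE_C2_def)
  have F_swap: "F w v = - F v w" if "v \<in> rL" "w \<in> rL" for v w
    using R.cochain_swap[OF F_C2 that] .
  have F_cocycle: "CE_d2 rbr F u v w = 0" if "u \<in> rL" "v \<in> rL" "w \<in> rL" for u v w
    using F_Z2 that by (auto simp: CE_Z2_def)
  note [simp] = T_closed degree_in_T parts_in_rL rs_parts fun_scale_zero
  have F_0: "F w 0 = 0" "F 0 w = 0" if "w \<in> rL" for w
    using F_scale[of 0 w 0] that R.L_closed(1) by simp_all
  note root_eig = nil_part_eigenvector and tor_eig = tor_part_eigenvector
  define C where "C t n = fst (F (tor_part t) (nil_part n))" for t n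
  define \<phi> where "\<phi> n m = fst (F (nil_part n) (nil_part m))" for n m
  define \<omega> where "\<omega> t t' = snd (F (tor_part t) (tor_part t'))" for t t'
  have C_lin: "C t (n + m) = C t n + C t m" "C t (c \<cdot> n) = c \<cdot> C t n" if "t \<in> T" for t n m c
    using that by (simp_all add: C_def parts_linear F_add F_scale)
  have \<phi>_lin: "\<phi> (n + n') m = \<phi> n m + \<phi> n' m" "\<phi> m (n + n') = \<phi> m n + \<phi> m n'"
    "\<phi> (c \<cdot> n) m = c \<cdot> \<phi> n m" "\<phi> m (c \<cdot> n) = c \<cdot> \<phi> m n" for n n' m c
    by (simp_all add: \<phi>_def parts_linear F_add F_scale)
  have \<phi>_swap: "\<phi> m n = - \<phi> n m" for n m
    using F_swap[of "nil_part n" "nil_part m"] by (simp add: \<phi>_def)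
  have C_root: "(\<exists>c. C t (root_vec p q) = c \<cdot> root_vec p q) \<and> snd (F (tor_part t) (nil_part (root_vec p q))) = 0"
    if t: "t \<in> T" for t p q
  proof (cases "(p, q) = (0, 0)")
    case True
    then have "F (tor_part t) (nil_part (root_vec p q)) = 0"
      using t F_0[of "tor_part t"] by (simp add: root_vec_00 parts_linear)
    then show ?thesis by (auto simp: C_def intro: exI[of _ 0])
  next
    case False
    let ?w = "F (tor_part t) (nil_part (root_vec p q))"
    have w: "?w \<in> rL" "rbr (tor_part degree) ?w = rs (Complex (of_nat p) (of_nat q)) ?w"
      using t F_L hom[OF _ _ tor_eig[OF t] root_eig[of p q]] by simp_all
    have "Complex (of_nat p) (of_nat q) \<noteq> 0" using False by (auto simp: complex_eq_iff)
    then show ?thesis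
      using degree_eigenvector_R[OF w] degree_eigenspace[of "fst ?w" p q]
      unfolding C_def by metis
  qed
  have F_tn: "F (tor_part t) (nil_part n) = nil_part (C t n)" if t: "t \<in> T" for t n
  proof -
    have "n \<in> {n. snd (F (tor_part t) (nil_part n)) = 0}"
      by (rule root_induct)
        (use t C_root in \<open>auto simp: subspace_def parts_linear F_0 F_add F_scale\<close>)
    then show ?thesis by (simp add: C_def prod_eq_iff)
  qed
  have \<phi>_root: "(\<exists>c. \<phi> (root_vec p q) (root_vec p' q') = c \<cdot> root_vec (p + p') (q + q')) \<and>
     snd (F (nil_part (root_vec p q)) (nil_part (root_vec p' q'))) = 0" for p q p' q'
  proof (cases "(p, q) = (0, 0)")
    case True
    then have "F (nil_part (root_vec p q)) (nil_part (root_vec p' q')) = 0"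
      using F_0 by (simp add: root_vec_00 parts_linear)
    then show ?thesis by (auto simp: \<phi>_def intro: exI[of _ 0])
  next
    case False
    let ?w = "F (nil_part (root_vec p q)) (nil_part (root_vec p' q'))"
    have "Complex (of_nat p) (of_nat q) + Complex (of_nat p') (of_nat q') =
        Complex (of_nat (p + p')) (of_nat (q + q'))" by (simp add: complex_eq_iff)
    then have w: "?w \<in> rL" "rbr (tor_part degree) ?w = rs (Complex (of_nat (p + p')) (of_nat (q + q'))) ?w"
      using F_L hom[OF _ _ root_eig[of p q] root_eig[of p' q']] by simp_all
    have "Complex (of_nat (p + p')) (of_nat (q + q')) \<noteq> 0" using False by (auto simp: complex_eq_iff)
    then show ?thesis
      using degree_eigenvector_R[OF w] degree_eigenspace[of "fst ?w" "p + p'" "q + q'"]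
      unfolding \<phi>_def by metis
  qed
  have F_nt: "F (nil_part n) (tor_part t) = nil_part (- C t n)" if t: "t \<in> T" for t n
    using F_swap[of "tor_part t" "nil_part n"] F_tn[OF t, of n] t by (simp add: prod_eq_iff)
  have F_nn: "F (nil_part n) (nil_part m) = nil_part (\<phi> n m)" for n m
  proof -
    have 1: "snd (F (nil_part (root_vec p q)) (nil_part m)) = 0" for p q m
    proof -
      have "m \<in> {m. snd (F (nil_part (root_vec p q)) (nil_part m)) = 0}"
        by (rule root_induct)
          (use \<phi>_root in \<open>auto simp: subspace_def parts_linear F_0 F_add F_scale\<close>)
      then show ?thesis by simp
    qed
    have "n \<in> {n. snd (F (nil_part n) (nil_part m)) = 0}"
      by (rule root_induct)
        (use 1 in \<open>auto simp: subspace_def parts_linear F_0 F_add F_scale\<close>)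
    then show ?thesis by (simp add: \<phi>_def prod_eq_iff)
  qed
  have F_tt: "F (tor_part t) (tor_part t') = tor_part (\<omega> t t')" if t: "t \<in> T" "t' \<in> T" for t t'
  proof -
    let ?w = "F (tor_part t) (tor_part t')"
    have w: "?w \<in> rL" "rbr (tor_part degree) ?w = rs 0 ?w"
      using t F_L hom[OF _ _ tor_eig[OF t(1)] tor_eig[OF t(2)]] by simp_all
    from degree_eigenvector_R(3)[OF w] show ?thesis
      by (simp add: \<omega>_def prod_eq_iff)
  qed
  have \<omega>_T: "\<omega> t t' \<in> T" if "t \<in> T" "t' \<in> T" for t t'
    using F_L[of "tor_part t" "tor_part t'"] F_tt[OF that] that by simp
  have C_comm: "C t (t' n) = t' (C t n)" if t: "t \<in> T" "t' \<in> T" for t t' n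
  proof -
    have "n \<in> {n. C t (t' n) = t' (C t n)}"
    proof (rule root_induct)
      show "subspace {n. C t (t' n) = t' (C t n)}"
        using t C_lin(2)[OF t(1), of 0 0] by (auto simp: subspace_def C_lin T_linear)
      show "root_vec p q \<in> {n. C t (t' n) = t' (C t n)}" for p q
      proof -
        obtain c where "C t (root_vec p q) = c \<cdot> root_vec p q" using C_root[OF t(1)] by blast
        moreover obtain a b where "\<And>p q. t' (root_vec p q) = (of_nat p * a + of_nat q * b) \<cdot> root_vec p q"
          by (rule T_root_vec[OF t(2)]) (rule that)
        ultimately show ?thesis using t by (simp add: C_lin T_linear mult.commute)
      qed
    qed
    then show ?thesis by simp
  qed
  have \<omega>_0: "\<omega> t t' = 0" if t: "t \<in> T" "t' \<in> T" for t t'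
  proof
    fix n
    have "CE_d2 rbr F (tor_part t) (tor_part t') (nil_part n) = 0" using t by (intro F_cocycle) auto
    then have "t (C t' n) - t' (C t n) - \<omega> t t' n + - (C t' (t n)) - - (C t (t' n)) = 0"
      using t \<omega>_T[OF t] by (simp add: CE_d2_def F_tn F_nt F_tt rbr_parts F_0 prod_eq_iff)
    then show "\<omega> t t' n = 0 n" using t by (simp add: C_comm)
  qed
  \<comment> \<open>The defect of equivariance of \<open>\<phi>\<close> and the defect of \<open>C t\<close> as a derivation cancel; the first
    vanishes by homogeneity.\<close>
  have defects: "(t (\<phi> n m) - \<phi> (t n) m - \<phi> n (t m)) + (C t (br n m) - br (C t n) m - br n (C t m)) = 0"
    if t: "t \<in> T" for t n m
  proof -
    have "CE_d2 rbr F (tor_part t) (nil_part n) (nil_part m) = 0" using t by (intro F_cocycle) auto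
    then have "t (\<phi> n m) - br n (C t m) + br m (C t n) - \<phi> (t n) m + \<phi> (t m) n + C t (br n m) = 0"
      using t by (auto simp: CE_d2_def F_tn F_nn F_nt rbr_parts prod_eq_iff)
    then show ?thesis
      using br_swap[of m "C t n"] \<phi>_swap[of "t m" n] by (simp add: algebra_simps)
  qed
  have \<phi>_inv: "t (\<phi> n m) = \<phi> (t n) m + \<phi> n (t m)" if t: "t \<in> T" for t n m
  proof -
    obtain a b where ab: "\<And>p q. t (root_vec p q) = (of_nat p * a + of_nat q * b) \<cdot> root_vec p q"
      by (rule T_root_vec[OF t]) (rule that)
    have 1: "t (\<phi> (root_vec p q) (root_vec p' q')) = \<phi> (t (root_vec p q)) (root_vec p' q') + \<phi> (root_vec p q) (t (root_vec p' q'))"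
      for p q p' q'
    proof -
      obtain c where "\<phi> (root_vec p q) (root_vec p' q') = c \<cdot> root_vec (p + p') (q + q')"
        using \<phi>_root by blast
      then show ?thesis
        using t by (simp add: ab \<phi>_lin T_linear algebra_simps)
    qed
    have \<phi>_z: "\<phi> 0 m = 0" "\<phi> m 0 = 0" for m
      using \<phi>_lin(3)[of 0 0 m] \<phi>_lin(4)[of m 0 0] by simp_all
    have 2: "m \<in> {m. t (\<phi> (root_vec p q) m) = \<phi> (t (root_vec p q)) m + \<phi> (root_vec p q) (t m)}" for p q m
    proof (rule root_induct)
      show "subspace {m. t (\<phi> (root_vec p q) m) = \<phi> (t (root_vec p q)) m + \<phi> (root_vec p q) (t m)}"
        using t by (auto simp: subspace_def \<phi>_lin \<phi>_z T_linear scale_right_distrib)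
    qed (use 1 in simp)
    have "n \<in> {n. t (\<phi> n m) = \<phi> (t n) m + \<phi> n (t m)}"
    proof (rule root_induct)
      show "subspace {n. t (\<phi> n m) = \<phi> (t n) m + \<phi> n (t m)}"
        using t by (auto simp: subspace_def \<phi>_lin \<phi>_z T_linear scale_right_distrib)
    qed (use 2 in simp)
    then show ?thesis by simp
  qed
  have C_T: "C t \<in> T" if t: "t \<in> T" for t
  proof -
    have lin: "Vector_Spaces.linear scale scale (C t)" by unfold_locales (simp_all add: C_lin t)
    have der: "C t (br n m) = br (C t n) m + br n (C t m)" for n m
      using defects[OF t, of n m] \<phi>_inv[OF t, of n m] by (simp add: algebra_simps)
    obtain c1 c2 where c: "C t x = c1 \<cdot> x" "C t y = c2 \<cdot> y"
      using C_root[OF t, of 1 0] C_root[OF t, of 0 1] by (auto simp: root_vec_def)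
    let ?d = "\<lambda>u. C t u - (c1 \<cdot> d1 u + c2 \<cdot> d2 u)"
    have "?d \<in> derivations scale br"
      unfolding derivations_def mem_Collect_eq
    proof (intro conjI allI)
      show "Vector_Spaces.linear scale scale ?d"
        using d_in_T
        by unfold_locales (simp_all add: C_lin t T_linear scale_right_distrib scale_right_diff_distrib mult.commute)
      show "?d (br u v) = br (?d u) v + br u (?d v)" for u v
        using d_in_T by (simp add: der T_linear br_linear scale_right_distrib)
    qed
    from derivation_eq_0[OF this] have "C t u = c1 \<cdot> d1 u + c2 \<cdot> d2 u" for u
      using c by (simp add: d1_gens d2_gens)
    then have "C t = fun_scale scale c1 d1 + fun_scale scale c2 d2"
      by (simp add: fun_eq_iff fun_scale_def)
    then show ?thesis using d_in_T by simp
  qed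
  have C_tlin: "C (t + t') = C t + C t'" "C (fun_scale scale c t) = fun_scale scale c (C t)"
    if "t \<in> T" "t' \<in> T" for t t' c
    using that unfolding fun_eq_iff
    by (simp_all add: C_def parts_linear F_add F_scale) (simp add: fun_scale_def C_def)
  define h where "h v = (if v \<in> rL then tor_part (C (snd v)) else 0)" for v
  have h_C1: "h \<in> CE_C1 rs rL"
    unfolding CE_C1_def h_def using R.L_closed(2,5)
    by (auto simp: C_T C_tlin parts_linear T_closed parts_in_rL rs_parts)
  define G where "G = F - R.coboundary h"
  have G_Z2: "G \<in> CE_Z2 rs rL rbr" unfolding G_def using F_Z2 h_C1 by (rule R.diff_coboundary_in_Z2)
  have C_0: "C 0 = 0" using C_tlin(2)[of 0 0 0] by simp
  have h_parts: "h (nil_part n) = 0" "t \<in> T \<Longrightarrow> h (tor_part t) = tor_part (C t)" "h 0 = 0" for n t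
    by (simp_all add: h_def C_0 parts_linear)
  note G_simps = G_def R.coboundary_def CE_d1_def h_parts C_T rbr_parts R.br_zero_on
  have G_nn: "snd (G (nil_part n) (nil_part m)) = 0" for n m
    by (simp add: G_simps F_nn)
  have G_tn: "G (tor_part t) (nil_part m) = 0" if "t \<in> T" for t m
    using that by (simp add: G_simps F_tn) (simp add: prod_eq_iff)
  have G_tt: "G (tor_part t) (tor_part t') = 0" if "t \<in> T" "t' \<in> T" for t t'
    using that by (simp add: G_simps F_tt \<omega>_0 parts_linear)
  have G_C2: "G \<in> CE_C2 rs rL" using G_Z2 by (simp add: CE_Z2_def)
  have G_tor: "G (tor_part t) v = 0" if t: "t \<in> T" and v: "v \<in> rL" for t v
  proof -
    have "G (tor_part t) (nil_part (fst v) + tor_part (snd v)) =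
        G (tor_part t) (nil_part (fst v)) + G (tor_part t) (tor_part (snd v))"
      using G_C2 t v unfolding CE_C2_def by simp
    also have "\<dots> = 0" using t v by (simp add: G_tn G_tt)
    finally show ?thesis unfolding part_decomposition[symmetric] .
  qed
  show ?thesis using h_C1 G_tor G_nn unfolding G_def by (rule that)
qed

text \<open>If \<open>G\<close> vanishes as soon as one argument is in the torus, the cocycle identity at \<open>(t, n, m)\<close> says that its
  restriction to the nilpotent part is invariant under the torus. That restriction is the coboundary
  of some \<open>\<gamma>\<close> by the deformation argument, and as \<open>\<gamma>\<close> commutes with the torus, its extension by zero has
  coboundary \<open>G\<close>.\<close>

lemma nilpotent_cocycle_is_coboundary:
  assumes G_Z2: "G \<in> CE_Z2 rs rL rbr"
    and G_tor: "\<And>t v. \<lbrakk>t \<in> T; v \<in> rL\<rbrakk> \<Longrightarrow> G (tor_part t) v = 0"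
    and G_nil: "\<And>n m. snd (G (nil_part n) (nil_part m)) = 0"
  shows "G \<in> CE_B2 rs rL rbr"
proof -
  interpret R: lie_algebra rs rL rbr by (rule lie_R)
  note [simp] = T_closed parts_in_rL rs_parts fun_scale_zero
  have G_C2: "G \<in> CE_C2 rs rL" using G_Z2 by (simp add: CE_Z2_def)
  have G_add: "G (u + v) w = G u w + G v w" "G w (u + v) = G w u + G w v"
    if "u \<in> rL" "v \<in> rL" "w \<in> rL" for u v w using G_C2 that by (auto simp: CE_C2_def)
  have G_scale: "G (rs c v) w = rs c (G v w)" "G w (rs c v) = rs c (G w v)"
    if "v \<in> rL" "w \<in> rL" for v w c using G_C2 that by (auto simp: CE_C2_def)
  have G_swap: "G w v = - G v w" if "v \<in> rL" "w \<in> rL" for v w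
    using R.cochain_swap[OF G_C2 that] .
  have G_tor': "G v (tor_part t) = 0" if "t \<in> T" "v \<in> rL" for t v
    using G_swap[of "tor_part t" v] G_tor[OF that] that by simp
  define \<phi> where "\<phi> n m = fst (G (nil_part n) (nil_part m))" for n m
  have \<phi>_lin: "\<phi> (n + n') m = \<phi> n m + \<phi> n' m" "\<phi> m (n + n') = \<phi> m n + \<phi> m n'"
    "\<phi> (c \<cdot> n) m = c \<cdot> \<phi> n m" "\<phi> m (c \<cdot> n) = c \<cdot> \<phi> m n" for n n' m c
    by (simp_all add: \<phi>_def parts_linear G_add G_scale)
  have \<phi>_swap: "\<phi> m n = - \<phi> n m" for n m
    using G_swap[of "nil_part n" "nil_part m"] by (simp add: \<phi>_def)
  have \<phi>_self: "\<phi> n n = 0" for n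
    using G_C2 by (simp add: \<phi>_def CE_C2_def)
  have G_nn: "G (nil_part n) (nil_part m) = nil_part (\<phi> n m)" for n m
    using G_nil[of n m] by (simp add: \<phi>_def prod_eq_iff)
  have G_val: "G v w = nil_part (\<phi> (fst v) (fst w))" if vw: "v \<in> rL" "w \<in> rL" for v w
  proof -
    let ?n = "nil_part (fst v)" and ?m = "nil_part (fst w)"
      and ?t = "tor_part (snd v)" and ?t' = "tor_part (snd w)"
    have "G v w = G (?n + ?t) (?m + ?t')" unfolding part_decomposition[symmetric] ..
    also have "\<dots> = G ?n ?m + G ?t ?m + (G ?n ?t' + G ?t ?t')"
      using vw by (simp add: G_add R.L_closed)
    also have "\<dots> = nil_part (\<phi> (fst v) (fst w))"
      using vw by (simp add: G_nn G_tor G_tor')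
    finally show ?thesis .
  qed
  have \<phi>_inv: "t (\<phi> n m) = \<phi> (t n) m + \<phi> n (t m)" if t: "t \<in> T" for t n m
  proof -
    have "CE_d2 rbr G (tor_part t) (nil_part n) (nil_part m) = 0" using G_Z2 t by (auto simp: CE_Z2_def)
    then have "t (\<phi> n m) - \<phi> (t n) m + \<phi> (t m) n = 0"
      using t by (auto simp: CE_d2_def G_tor G_tor' G_nn rbr_parts R.br_zero_on prod_eq_iff)
    then show ?thesis using \<phi>_swap[of "t m" n] by (simp add: algebra_simps)
  qed
  have \<phi>_Z2: "\<phi> \<in> CE_Z2 scale UNIV br"
  proof -
    have "CE_d2 br \<phi> u v w = 0" for u v w
    proof -
      have "CE_d2 rbr G (nil_part u) (nil_part v) (nil_part w) = 0" using G_Z2 by (auto simp: CE_Z2_def)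
      then show ?thesis by (simp add: CE_d2_def G_nn rbr_parts prod_eq_iff)
    qed
    then show ?thesis by (simp add: CE_Z2_def CE_C2_def \<phi>_lin \<phi>_self)
  qed
  obtain \<gamma> where \<gamma>: "Vector_Spaces.linear scale scale \<gamma>"
    "\<And>u. \<gamma> (d1 u) = d1 (\<gamma> u)" "\<And>u. \<gamma> (d2 u) = d2 (\<gamma> u)"
    "\<And>u v. \<phi> u v = br u (\<gamma> v) - br v (\<gamma> u) - \<gamma> (br u v)"
    using invariant_cocycle_trivial[OF \<phi>_Z2] \<phi>_inv[OF d_in_T(1)] \<phi>_inv[OF d_in_T(2)] by blast
  interpret \<gamma>: Vector_Spaces.linear scale scale \<gamma> by (rule \<gamma>(1))
  have \<gamma>_comm: "\<gamma> (t u) = t (\<gamma> u)" if t: "t \<in> T" for t u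
  proof -
    obtain a b where "\<And>u. t u = a \<cdot> d1 u + b \<cdot> d2 u" using T_combination[OF t] by blast
    then show ?thesis by (simp add: \<gamma>.add \<gamma>.scale \<gamma>(2,3))
  qed
  define k where "k v = (if v \<in> rL then nil_part (\<gamma> (fst v)) else 0)" for v
  have k_C1: "k \<in> CE_C1 rs rL"
    unfolding CE_C1_def k_def using R.L_closed(2,5)
    by (auto simp: \<gamma>.add \<gamma>.scale parts_linear)
  have "G v w = R.coboundary k v w" for v w
  proof (cases "v \<in> rL \<and> w \<in> rL")
    case True
    then have "snd v \<in> T" "snd w \<in> T" by simp_all
    with True show ?thesis
      by (simp add: G_val R.coboundary_def CE_d1_def k_def semidirect_bracket_def prod_eq_iff
          T_linear \<gamma>.add \<gamma>.diff \<gamma>.neg \<gamma>_comm \<gamma>(4) algebra_simps)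
  next
    case False
    then have "G v w = 0" using G_C2 unfolding CE_C2_def by blast
    with False show ?thesis by (auto simp: R.coboundary_def)
  qed
  then have "G = R.coboundary k" by (simp add: fun_eq_iff)
  then show ?thesis using R.coboundary_in_B2[OF k_C1] by simp
qed

lemma cocycle_is_coboundary:
  assumes f: "f \<in> CE_Z2 rs rL rbr"
  shows "f \<in> CE_B2 rs rL rbr"
proof -
  interpret R: lie_algebra rs rL rbr by (rule lie_R)
  obtain g where g: "g \<in> CE_C1 rs rL" and hom:
    "\<And>v w l m. \<lbrakk>v \<in> rL; w \<in> rL; rbr (tor_part degree) v = rs l v; rbr (tor_part degree) w = rs m w\<rbrakk> \<Longrightarrow>
      rbr (tor_part degree) ((f - R.coboundary g) v w) = rs (l + m) ((f - R.coboundary g) v w)"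
    by (rule homogeneous_cocycle[OF f]) blast
  have F: "f - R.coboundary g \<in> CE_Z2 rs rL rbr" using f g by (rule R.diff_coboundary_in_Z2)
  obtain h where h: "h \<in> CE_C1 rs rL"
    and tor: "\<And>t v. \<lbrakk>t \<in> T; v \<in> rL\<rbrakk> \<Longrightarrow> (f - R.coboundary g - R.coboundary h) (tor_part t) v = 0"
    and nil: "\<And>n m. snd ((f - R.coboundary g - R.coboundary h) (nil_part n) (nil_part m)) = 0"
    by (rule normalize_torus_part[OF F hom]) blast+
  have "f - R.coboundary g - R.coboundary h \<in> CE_B2 rs rL rbr"
    using R.diff_coboundary_in_Z2[OF F h] tor nil by (rule nilpotent_cocycle_is_coboundary)
  then have "f - R.coboundary g \<in> CE_B2 rs rL rbr"
    using h by (rule R.in_B2_if_diff_coboundary_in_B2)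
  then show ?thesis using g by (rule R.in_B2_if_diff_coboundary_in_B2)
qed

theorem semidirect_cohomologically_rigid: "cohomologically_rigid rs rL rbr"
  by (intro lie_algebra.cohomologically_rigidI[OF lie_R] subsetI cocycle_is_coboundary)

end

section \<open>Cohomological rigidity\<close>

theorem theorem4p7:
  fixes s :: "complex \<Rightarrow> 'n::ab_group_add \<Rightarrow> 'n"
    and br :: "'n \<Rightarrow> 'n \<Rightarrow> 'n"
    and T :: "('n \<Rightarrow> 'n) set"
    and \<alpha>\<^sub>1 \<alpha>\<^sub>2 :: "('n \<Rightarrow> 'n) \<Rightarrow> complex"
  assumes "lie_algebra s UNIV br" and "finite_dim s" and "nilpotent_lie s br"
    and "maximal_torus s br T"
    and "vector_space.dim (fun_scale s) T = 2"
    and "quotient_dim s (derived_subalgebra s br) = 2"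
    and "\<forall>\<alpha>\<in>weights s T. vector_space.dim s (weight_space s T \<alpha>) = 1"
    and "primitive_weights s br T = {\<alpha>\<^sub>1, \<alpha>\<^sub>2}" and "\<alpha>\<^sub>1 \<noteq> \<alpha>\<^sub>2"
    and "nilindex s br > 3"
    and "(\<lambda>x. 3 * \<alpha>\<^sub>1 x + \<alpha>\<^sub>2 x) \<notin> weights s T"
    and "(\<lambda>x. \<alpha>\<^sub>1 x + 3 * \<alpha>\<^sub>2 x) \<notin> weights s T"
  shows "cohomologically_rigid (semidirect_scale s) (semidirect_carrier T) (semidirect_bracket br)"
proof -
  interpret lie_algebra s UNIV br by fact
  interpret char0_lie_algebra s br by unfold_locales
  interpret F: vector_space "fun_scale s"
    by (rule vector_space_fun_scale) (rule vector_space_axioms)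
  let ?U = "derived_subalgebra s br"
  have torus: "torus s br T" using assms(4) by (simp add: maximal_torus_def)
  then have T_sub: "F.subspace T" and T_der: "\<And>t. t \<in> T \<Longrightarrow> t \<in> derivations s br"
    by (auto simp: torus_def)
  note T_closed = F.subspace_0[OF T_sub] F.subspace_add[OF T_sub] F.subspace_diff[OF T_sub]
    F.subspace_scale[OF T_sub]
  have T_linear: "Vector_Spaces.linear s s t" if "t \<in> T" for t
    using T_der[OF that] by (simp add: derivations_def)
  have dual: "\<alpha>\<^sub>1 \<in> dual_space s T" "\<alpha>\<^sub>2 \<in> dual_space s T"
    using assms(8) by (auto simp: primitive_weights_def)
  have dual_lin: "\<alpha> (t + t') = \<alpha> t + \<alpha> t'" "\<alpha> (fun_scale s c t) = c * \<alpha> t" "\<alpha> (t - t') = \<alpha> t - \<alpha> t'"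
    if "\<alpha> \<in> dual_space s T" "t \<in> T" "t' \<in> T" for \<alpha> t t' c
  proof -
    have add: "\<alpha> (u + u') = \<alpha> u + \<alpha> u'" if "u \<in> T" "u' \<in> T" for u u'
      using \<open>\<alpha> \<in> dual_space s T\<close> that by (auto simp: dual_space_def)
    then show "\<alpha> (t + t') = \<alpha> t + \<alpha> t'" using that by blast
    show "\<alpha> (fun_scale s c t) = c * \<alpha> t" using that by (auto simp: dual_space_def)
    show "\<alpha> (t - t') = \<alpha> t - \<alpha> t'"
      using add[OF T_closed(3)[OF that(2,3)] that(3)] by simp
  qed
  obtain B where B: "B \<subseteq> T" "F.independent B" "T \<subseteq> F.span B" "card B = 2"
    using F.basis_exists[of T] assms(5) by metis
  then obtain t1 t2 where B_eq: "B = {t1, t2}" and t12: "t1 \<noteq> t2" by (auto simp: card_2_iff)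
  have T12: "t1 \<in> T" "t2 \<in> T" using B(1) B_eq by auto

  \<comment> \<open>Both sides of the eigenvalue equation are linear in \<open>t\<close>, so it suffices to lift for the basis \<open>B\<close>.\<close>
  have weight_vector: "\<exists>e. e \<notin> ?U \<and> (\<forall>t\<in>T. t e = s (\<alpha> t) e)" if prim: "\<alpha> \<in> primitive_weights s br T" for \<alpha>
  proof -
    have \<alpha>: "\<alpha> \<in> dual_space s T" using prim by (simp add: primitive_weights_def)
    obtain e where e: "e \<notin> ?U" "\<And>t. t \<in> T \<Longrightarrow> t e - s (\<alpha> t) e \<in> ?U"
      using prim by (auto simp: primitive_weights_def)
    obtain e' where e': "e' - e \<in> ?U" "\<And>t. t \<in> B \<Longrightarrow> t e' = s (\<alpha> t) e'"
      using lift_weight_vector[OF torus, of B e \<alpha>] B(1) e(2) B_eq by auto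
    have "T \<subseteq> {t \<in> T. t e' = s (\<alpha> t) e'}"
    proof -
      have "\<alpha> 0 = 0" using dual_lin(2)[OF \<alpha>, of 0 0 0] T_closed(1) by (simp add: fun_scale_def zero_fun_def)
      then have "F.subspace {t \<in> T. t e' = s (\<alpha> t) e'}"
        using T_closed by (auto simp: F.subspace_def dual_lin[OF \<alpha>] scale_left_distrib)
          (simp add: fun_scale_def)
      then have "F.span B \<subseteq> {t \<in> T. t e' = s (\<alpha> t) e'}"
        using e'(2) B(1) by (intro F.span_minimal) auto
      with B(3) show ?thesis by auto
    qed
    moreover have "e' \<notin> ?U"
      using e(1) subspace_diff[OF subspace_derived, of e' "e' - e"] e'(1) by auto
    ultimately show ?thesis by blast
  qed
  obtain x where x: "x \<notin> ?U" "\<And>t. t \<in> T \<Longrightarrow> t x = s (\<alpha>\<^sub>1 t) x"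
    using weight_vector[of \<alpha>\<^sub>1] assms(8) by auto
  obtain y where y: "y \<notin> ?U" "\<And>t. t \<in> T \<Longrightarrow> t y = s (\<alpha>\<^sub>2 t) y"
    using weight_vector[of \<alpha>\<^sub>2] assms(8) by auto

  have span_U: "span ?U = ?U" using subspace_derived by (simp only: span_eq_iff)
  have x_indep: "x \<notin> span (insert y ?U)"
  proof
    assume "x \<in> span (insert y ?U)"
    then obtain k where k: "x - s k y \<in> ?U"
      using span_breakdown_eq[of x y ?U] span_U by auto
    obtain t where t: "\<alpha>\<^sub>1 t \<noteq> \<alpha>\<^sub>2 t" using assms(9) by (auto simp: fun_eq_iff)
    have "\<forall>t. t \<notin> T \<longrightarrow> \<alpha>\<^sub>1 t = 0 \<and> \<alpha>\<^sub>2 t = 0" using dual by (simp add: dual_space_def)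
    with t have tT: "t \<in> T" by metis
    interpret t: Vector_Spaces.linear s s t by (rule T_linear[OF tT])
    have "t (x - s k y) - s (\<alpha>\<^sub>2 t) (x - s k y) = s (\<alpha>\<^sub>1 t - \<alpha>\<^sub>2 t) x"
      using tT by (simp add: t.diff t.scale x y scale_right_diff_distrib scale_left_diff_distrib mult.commute)
    moreover have "t (x - s k y) - s (\<alpha>\<^sub>2 t) (x - s k y) \<in> ?U"
      using k derivation_derived[OF T_der[OF tT] k] subspace_derived
      by (simp add: subspace_diff subspace_scale)
    ultimately have "s (1 / (\<alpha>\<^sub>1 t - \<alpha>\<^sub>2 t)) (s (\<alpha>\<^sub>1 t - \<alpha>\<^sub>2 t) x) \<in> ?U"
      using subspace_scale[OF subspace_derived] by metis
    with t x(1) show False by simp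
  qed
  have spanning: "span (insert x (insert y ?U)) = UNIV"
  proof -
    obtain B0 where "finite B0" "span B0 = UNIV" using assms(2) by (auto simp: finite_dim_def)
    moreover obtain B1 where B1: "B1 \<subseteq> B0" "independent B1" "B0 \<subseteq> span B1"
      using maximal_independent_subset .
    ultimately have "finite B1" "span B1 = UNIV"
      using finite_subset span_minimal[OF B1(3) subspace_span] by auto
    with B1(2) interpret N: finite_dimensional_vector_space s B1 by unfold_locales
    have "y \<notin> span ?U" unfolding span_U by (rule y(1))
    with x_indep have "dim (insert x (insert y ?U)) = dim ?U + 2" by (simp add: N.dim_insert)
    also have "\<dots> = dim UNIV" using assms(6) by (simp add: quotient_dim_def)
    finally show ?thesis using N.dim_eq_full by (simp add: N.dim_UNIV N.dimension_def)
  qed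
  have generated: "S = UNIV"
    if "subspace S" "x \<in> S" "y \<in> S" "\<And>u v. u \<in> S \<Longrightarrow> v \<in> S \<Longrightarrow> br u v \<in> S" for S
  proof (rule subalgebra_eq_UNIV[OF assms(3) that(1,4)])
    fix u
    obtain a b where "u - s a x - s b y \<in> ?U"
      using spanning span_breakdown_eq span_U by (metis UNIV_I)
    then have "u - (s a x + s b y) \<in> ?U" by (simp add: diff_diff_eq)
    moreover have "s a x + s b y \<in> S" using that(1-3) by (simp add: subspace_add subspace_scale)
    ultimately show "\<exists>v\<in>S. u - v \<in> ?U" by blast
  qed
  have T_eq_0: "t = 0" if t: "t \<in> T" "\<alpha>\<^sub>1 t = 0" "\<alpha>\<^sub>2 t = 0" for t
  proof -
    interpret t: Vector_Spaces.linear s s t by (rule T_linear[OF t(1)])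
    have "{u. t u = 0} = UNIV"
    proof (rule generated)
      show "br u v \<in> {u. t u = 0}" if "u \<in> {u. t u = 0}" "v \<in> {u. t u = 0}" for u v
        using that T_der[OF t(1)] by (simp add: derivations_def br_linear)
    qed (use x(2)[OF t(1)] y(2)[OF t(1)] t(2,3) in \<open>auto simp: subspace_def t.zero t.add t.scale\<close>)
    then show ?thesis by (auto simp: fun_eq_iff)
  qed

  have indep2: "a = 0 \<and> b = 0" if "fun_scale s a t1 + fun_scale s b t2 = 0" for a b
  proof -
    have "(\<Sum>t\<in>B. fun_scale s (if t = t1 then a else b) t) = 0" using that t12 by (simp add: B_eq)
    then have "(if t = t1 then a else b) = 0" if "t \<in> B" for t
      using F.independentD[OF B(2) _ subset_refl, of "\<lambda>t. if t = t1 then a else b" t] that B_eq by simp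
    from this[of t1] this[of t2] show ?thesis using t12 by (simp add: B_eq)
  qed
  let ?comb = "\<lambda>a b. fun_scale s a t1 + fun_scale s b t2"
  have comb: "?comb a b \<in> T" "\<alpha>\<^sub>1 (?comb a b) = a * \<alpha>\<^sub>1 t1 + b * \<alpha>\<^sub>1 t2"
    "\<alpha>\<^sub>2 (?comb a b) = a * \<alpha>\<^sub>2 t1 + b * \<alpha>\<^sub>2 t2" for a b
    using T12 by (simp_all add: T_closed dual_lin dual)
  \<comment> \<open>An element of the torus on which \<open>\<alpha>\<^sub>1\<close> and \<open>\<alpha>\<^sub>2\<close> vanish is zero, so the matrix of their
    values on the basis \<open>t1\<close>, \<open>t2\<close> is invertible.\<close>
  define \<Delta> where "\<Delta> = \<alpha>\<^sub>1 t1 * \<alpha>\<^sub>2 t2 - \<alpha>\<^sub>1 t2 * \<alpha>\<^sub>2 t1"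
  have \<Delta>: "\<Delta> \<noteq> 0"
  proof
    assume "\<Delta> = 0"
    have zero: "?comb a b = 0"
      if "a * \<alpha>\<^sub>1 t1 + b * \<alpha>\<^sub>1 t2 = 0" "a * \<alpha>\<^sub>2 t1 + b * \<alpha>\<^sub>2 t2 = 0" for a b
      by (rule T_eq_0[OF comb(1)]) (simp_all only: comb that)
    have "?comb (\<alpha>\<^sub>2 t2) (- \<alpha>\<^sub>2 t1) = 0" "?comb (\<alpha>\<^sub>1 t2) (- \<alpha>\<^sub>1 t1) = 0"
      using \<open>\<Delta> = 0\<close> by (intro zero; simp add: \<Delta>_def mult.commute)+
    then have "- \<alpha>\<^sub>1 t1 = 0" "- \<alpha>\<^sub>2 t1 = 0" using indep2 by blast+
    then have "\<alpha>\<^sub>1 t1 = 0" "\<alpha>\<^sub>2 t1 = 0" by simp_all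
    then have "t1 = 0" using T12 T_eq_0 by blast
    then show False using indep2[of 1 0] by (simp add: fun_scale_def fun_eq_iff)
  qed
  \<comment> \<open>The basis of the torus dual to \<open>\<alpha>\<^sub>1\<close>, \<open>\<alpha>\<^sub>2\<close>.\<close>
  define d1 where "d1 = ?comb (\<alpha>\<^sub>2 t2 / \<Delta>) (- \<alpha>\<^sub>2 t1 / \<Delta>)"
  define d2 where "d2 = ?comb (- \<alpha>\<^sub>1 t2 / \<Delta>) (\<alpha>\<^sub>1 t1 / \<Delta>)"
  have dT: "d1 \<in> T" "d2 \<in> T" unfolding d1_def d2_def by (rule comb(1))+
  have d_dual: "\<alpha>\<^sub>1 d1 = 1" "\<alpha>\<^sub>2 d1 = 0" "\<alpha>\<^sub>1 d2 = 0" "\<alpha>\<^sub>2 d2 = 1"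
    unfolding d1_def d2_def comb using \<Delta> by (simp_all add: field_simps) (simp_all add: \<Delta>_def)
  have T_comb: "t u = s (\<alpha>\<^sub>1 t) (d1 u) + s (\<alpha>\<^sub>2 t) (d2 u)" if t: "t \<in> T" for t u
  proof -
    have "t - (fun_scale s (\<alpha>\<^sub>1 t) d1 + fun_scale s (\<alpha>\<^sub>2 t) d2) = 0"
      using t dT by (intro T_eq_0) (simp_all add: T_closed dual_lin dual d_dual)
    then have "t = fun_scale s (\<alpha>\<^sub>1 t) d1 + fun_scale s (\<alpha>\<^sub>2 t) d2" by simp
    from fun_cong[OF this, of u] show ?thesis by (simp add: fun_scale_def)
  qed
  have no_weight: "u = 0"
    if "(\<lambda>t. a * \<alpha>\<^sub>1 t + b * \<alpha>\<^sub>2 t) \<notin> weights s T" "d1 u = s a u" "d2 u = s b u" for a b u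
  proof -
    have "(\<lambda>t. a * \<alpha>\<^sub>1 t + b * \<alpha>\<^sub>2 t) \<in> dual_space s T"
      using dual by (auto simp: dual_space_def algebra_simps)
    with that(1) have "weight_space s T (\<lambda>t. a * \<alpha>\<^sub>1 t + b * \<alpha>\<^sub>2 t) = {0}" by (simp add: weights_def)
    moreover have "u \<in> weight_space s T (\<lambda>t. a * \<alpha>\<^sub>1 t + b * \<alpha>\<^sub>2 t)"
      using T_comb[of _ u] that(2,3) by (simp add: weight_space_def scale_left_distrib mult.commute)
    ultimately show ?thesis by simp
  qed
  interpret graded_semidirect s br x y d1 d2 T
  proof
    show "u = 0" if "d1 u = s 3 u" "d2 u = s 1 u" for u
      using no_weight[of 3 1 u] assms(11) that by simp
    show "u = 0" if "d1 u = s 1 u" "d2 u = s 3 u" for u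
      using no_weight[of 1 3 u] assms(12) that by simp
    show "\<exists>a b. \<forall>u. t u = s a (d1 u) + s b (d2 u)" if "t \<in> T" for t
      using T_comb[OF that] by blast
  qed (use T_der dT x(2)[OF dT(1)] x(2)[OF dT(2)] y(2)[OF dT(1)] y(2)[OF dT(2)] d_dual
      generated torus in auto)
  show ?thesis by (rule semidirect_cohomologically_rigid)
qed

end
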